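(* Let $c_1,\dots,c_{n-2}$ and $k$ be positive integers, and put $\mathbf{a}=(1^{(n-2)},2)$ (that is, $n-2$ ones followed by a $2$) and $\mathbf{c}=(c_1,\dots,c_{n-2},1)$. Let $$\Delta_{k,\mathbf{a},\mathbf{c}}=\Big\{x\in\mathbb{R}^n_{\ge 0} : \sum_{i=1}^n x_i=k,\ x_i\le c_i \text{ for } 1\le i\le n-2,\ x_{n-1}+x_n\le 1\Big\}.$$ The coefficient of $t^m$ in $(n-1)!\,\mathrm{ehr}(\Delta_{k,\mathbf{a},\mathbf{c}},t)$ can be described as follows, in terms of sets $S_1,S_2,S_3,S_4$ of cycle-ordered, weighted permutations of $[n]$. - $S_1$: if $k<n-1$ or $m+1>1$, let $S_1$ be the set of $(\mathbf{a},\mathbf{c})$-compatible cycle-ordered, weighted permutations of type $(n,m+1,k)$. Otherwise, if $k=n-1$ and $m+1=1$, let $S_1$ be the set of cycle-ordered, weighted permutations of type $(n,1,n-1)$ (note that these cycle-ordered, weighted permutations are not $(\mathbf{a},\mathbf{c})$-compatible). - $S_2$ is the set of cycle-ordered, weighted permutations $(\sigma,p,w)$ of type $(n,m+1,k)$ such that: the cycles of $\sigma$ not containing $n-1$ are properly $(\mathbf{a},\mathbf{c})$-weighted; $n-1$ and $n$ are in different cycles; the cycle containing $n-1$ is improperly $(\mathbf{a},\mathbf{c})$-weighted; and the cycle $\mathfrak{c}$ containing $n$ satisfies $w(\mathfrak{c})=\sum_{i\in\mathfrak{c},\,i\ne n}c_i$. - $S_3$ is the set of cycle-ordered, weighted permutations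 $(\sigma,p,w)$ of type $(n,m,k)$ such that: the cycles not containing $n-1$ or $n$ are properly $(\mathbf{a},\mathbf{c})$-weighted; $n-1$ and $n$ are in distinct cycles; the cycle containing $n-1$ is improperly $(\mathbf{a},\mathbf{c})$-weighted; and the cycle $\mathfrak{c}$ containing $n$ satisfies $w(\mathfrak{c})<\sum_{i\in\mathfrak{c},\,i\ne n}c_i$. - $S_4$: if $m>1$, let $S_4$ be the set of cycle-ordered, weighted permutations $(\sigma,p,w)$ of type $(n,m,k)$ such that $n-1$ and $n$ are in the same cycle, which is improperly $(\mathbf{a},\mathbf{c})$-weighted, and the remaining cycles are properly $(\mathbf{a},\mathbf{c})$-weighted. Otherwise, if $m=1$, let $S_4=\emptyset$. Then $$[t^m]\,(n-1)!\,\mathrm{ehr}(\Delta_{k,\mathbf{a},\mathbf{c}},t)=|S_1|+|S_2|-|S_3|-|S_4|=|S_1\cup S_2|-|S_3\cup S_4|.$$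
   Context: For a polytope $P\subset\mathbb{R}^n$ with integral vertices, $\mathrm{ehr}(P,t)$ is the (Ehrhart) polynomial in $t$ with $\mathrm{ehr}(P,t)=\#(tP\cap\mathbb{Z}^n)$ for all positive integers $t$; $[t^m]$ denotes the coefficient of $t^m$. For a permutation $\sigma$, $C(\sigma)$ denotes the set of cycles in its cycle decomposition (fixed points count as cycles of length 1). For a permutation $p=[p_1,\dots,p_r]$ of $[r]=\{1,\dots,r\}$ in one-line notation, $\mathrm{Des}(p)=\{1\le i\le r-1 : p_i>p_{i+1}\}$ and $\mathrm{des}(p)=|\mathrm{Des}(p)|$. A cycle-ordered, weighted permutation of $[n]$ is a triple $(\sigma,p,w)$ where $\sigma$ is a permutation of $[n]$; $p$ is a permutation of $[r]$ with $p(r)=1$, where $r=|C(\sigma)|$; and $w:C(\sigma)\to\mathbb{N}_0=\{0,1,2,\dots\}$ is a function. The value $w(\mathfrak{c})$ is the weight of the cycle $\mathfrak{c}$, and the total weight is $w(\sigma)=\sum_{\mathfrak{c}\in C(\sigma)}w(\mathfrak{c})$. The triple $(\sigma,p,w)$ is of type $(n,r,k)$ if $|C(\sigma)|=r$ and $k=w(\sigma)+\mathrm{des}(p)$. There are none of type $(n,0,k)$, so for $m=0$ the sets $S_3$ and $S_4$ are empty. For $\mathbf{a}=(1^{(n-2)},2)$ and $\mathbf{c}=(c_1,\dots,c_{n-2},1)$, a cycle $\mathfrak{c}\in C(\sigma)$ of $(\sigma,p,w)$ is properly $(\mathbf{a},\mathbf{c})$-weighted if: (1) when neither $n-1$ nor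 $n$ is in $\mathfrak{c}$, $w(\mathfrak{c})<\sum_{i\in\mathfrak{c}}c_i$; (2) when $n-1$ or $n$ (or both) is in $\mathfrak{c}$, $w(\mathfrak{c})<1+\sum_{i\in\mathfrak{c},\,i\le n-2}c_i$. Otherwise the cycle is improperly $(\mathbf{a},\mathbf{c})$-weighted. The triple $(\sigma,p,w)$ is $(\mathbf{a},\mathbf{c})$-compatible if each cycle of $\sigma$ is properly $(\mathbf{a},\mathbf{c})$-weighted. In $S_2$ and $S_3$, the sum $\sum_{i\in\mathfrak{c},\,i\ne n}c_i$ is over a cycle not containing $n-1$, so it only involves $c_1,\dots,c_{n-2}$; an empty sum is $0$.
   Formalization: Δ is assumed non-empty, i.e. k ≤ c_1+…+c_{n-2}+1 (otherwise the identity fails at m=1, e.g. n=k=2); for m=0 and k>n−1, where the statement leaves S_1 undefined, S_1 is taken to be the set of all triples of type (n,1,k). *)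

theory Defs
  imports
    Complex_Main
    "HOL-Library.FuncSet"
    "HOL-Computational_Algebra.Polynomial"
    "HOL-Combinatorics.Combinatorics"
begin

section \<open>Lattice points and the Ehrhart polynomial\<close>

text \<open>The dimension \<open>n\<close> is a term here, so a vector of \<open>n\<close>-space is a function on \<open>nat\<close>
  with coordinates \<open>x 1, \<dots>, x n\<close> that vanishes at every other index.\<close>

definition real_space :: "nat \<Rightarrow> (nat \<Rightarrow> real) set" where
  "real_space n = {x. \<forall>i. i \<notin> {1..n} \<longrightarrow> x i = 0}"

definition int_lattice :: "nat \<Rightarrow> (nat \<Rightarrow> real) set" where
  "int_lattice n = {x \<in> real_space n. \<forall>i\<in>{1..n}. x i \<in> \<int>}"

definition dilate :: "nat \<Rightarrow> (nat \<Rightarrow> real) set \<Rightarrow> (nat \<Rightarrow> real) set" where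
  "dilate t P = (\<lambda>x i. real t * x i) ` P"

definition ehr :: "nat \<Rightarrow> (nat \<Rightarrow> real) set \<Rightarrow> real poly" where
  "ehr n P = (THE q. \<forall>t>0. poly q (real t) = real (card (dilate t P \<inter> int_lattice n)))"

text \<open>Only \<open>c 1, \<dots>, c (n - 2)\<close> are used, here and below; the last entry of the vector
  \<open>(c\<^sub>1, \<dots>, c\<^sub>n\<^sub>-\<^sub>2, 1)\<close> is the constant \<open>1\<close> in the bounds involving \<open>n - 1\<close> and \<open>n\<close>.
  The set is empty iff \<open>k > c\<^sub>1 + \<dots> + c\<^sub>n\<^sub>-\<^sub>2 + 1\<close>; it is then not regarded as a polytope, and the
  coefficient formula fails for it at \<open>m = 1\<close>.\<close>

definition slice :: "nat \<Rightarrow> (nat \<Rightarrow> nat) \<Rightarrow> nat \<Rightarrow> (nat \<Rightarrow> real) set" where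
  "slice n c k = {x \<in> real_space n.
     (\<forall>i\<in>{1..n}. 0 \<le> x i) \<and> (\<Sum>i=1..n. x i) = real k \<and>
     (\<forall>i\<in>{1..n-2}. x i \<le> real (c i)) \<and> x (n - 1) + x n \<le> 1}"


section \<open>Cycle-ordered, weighted permutations\<close>

text \<open>A cycle of \<open>\<sigma>\<close> is represented by its underlying set, which determines it once \<open>\<sigma>\<close> is
  given; the cycle containing \<open>i\<close> is \<open>orbit \<sigma> i\<close>.\<close>

definition cyc :: "nat \<Rightarrow> (nat \<Rightarrow> nat) \<Rightarrow> nat set set" where
  "cyc n \<sigma> = orbit \<sigma> ` {1..n}"

definition des :: "nat \<Rightarrow> (nat \<Rightarrow> nat) \<Rightarrow> nat" where
  "des r p = card {i. 1 \<le> i \<and> i < r \<and> p i > p (i + 1)}"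

type_synonym cowp = "(nat \<Rightarrow> nat) \<times> (nat \<Rightarrow> nat) \<times> (nat set \<Rightarrow> nat)"

text \<open>The weight function is extensional, so that each function on the set of cycles is
  counted once.\<close>

definition cowps :: "nat \<Rightarrow> cowp set" where
  "cowps n = {(\<sigma>, p, w). \<sigma> permutes {1..n} \<and>
     p permutes {1..card (cyc n \<sigma>)} \<and> p (card (cyc n \<sigma>)) = 1 \<and>
     w \<in> cyc n \<sigma> \<rightarrow>\<^sub>E UNIV}"

definition cowps_type :: "nat \<Rightarrow> nat \<Rightarrow> nat \<Rightarrow> cowp set" where
  "cowps_type n r k = {(\<sigma>, p, w) \<in> cowps n.
     card (cyc n \<sigma>) = r \<and> k = (\<Sum>\<gamma>\<in>cyc n \<sigma>. w \<gamma>) + des r p}"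

definition proper :: "nat \<Rightarrow> (nat \<Rightarrow> nat) \<Rightarrow> (nat set \<Rightarrow> nat) \<Rightarrow> nat set \<Rightarrow> bool" where
  "proper n c w \<gamma> \<longleftrightarrow>
     (if n - 1 \<notin> \<gamma> \<and> n \<notin> \<gamma> then w \<gamma> < (\<Sum>i\<in>\<gamma>. c i)
      else w \<gamma> < 1 + (\<Sum>i | i \<in> \<gamma> \<and> i \<le> n - 2. c i))"

definition compatible :: "nat \<Rightarrow> (nat \<Rightarrow> nat) \<Rightarrow> cowp \<Rightarrow> bool" where
  "compatible n c = (\<lambda>(\<sigma>, p, w). \<forall>\<gamma>\<in>cyc n \<sigma>. proper n c w \<gamma>)"


section \<open>The four sets\<close>

text \<open>The source states the second case of \<open>S1\<close> for \<open>m = 0\<close> and \<open>k = n - 1\<close> only and leaves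
  \<open>S1\<close> unspecified for \<open>m = 0\<close> and \<open>k > n - 1\<close>; there the same prescription, all triples of type
  \<open>(n, 1, k)\<close>, is used.  It agrees with the set of compatible ones unless
  \<open>k > c\<^sub>1 + \<dots> + c\<^sub>n\<^sub>-\<^sub>2\<close>.\<close>

definition S1 :: "nat \<Rightarrow> (nat \<Rightarrow> nat) \<Rightarrow> nat \<Rightarrow> nat \<Rightarrow> cowp set" where
  "S1 n c k m =
     (if k < n - 1 \<or> m + 1 > 1 then {T \<in> cowps_type n (m + 1) k. compatible n c T}
      else cowps_type n 1 k)"

definition S2 :: "nat \<Rightarrow> (nat \<Rightarrow> nat) \<Rightarrow> nat \<Rightarrow> nat \<Rightarrow> cowp set" where
  "S2 n c k m = {(\<sigma>, p, w) \<in> cowps_type n (m + 1) k.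
     (\<forall>\<gamma>\<in>cyc n \<sigma>. n - 1 \<notin> \<gamma> \<longrightarrow> proper n c w \<gamma>) \<and>
     orbit \<sigma> (n - 1) \<noteq> orbit \<sigma> n \<and>
     \<not> proper n c w (orbit \<sigma> (n - 1)) \<and>
     w (orbit \<sigma> n) = (\<Sum>i\<in>orbit \<sigma> n - {n}. c i)}"

definition S3 :: "nat \<Rightarrow> (nat \<Rightarrow> nat) \<Rightarrow> nat \<Rightarrow> nat \<Rightarrow> cowp set" where
  "S3 n c k m = {(\<sigma>, p, w) \<in> cowps_type n m k.
     (\<forall>\<gamma>\<in>cyc n \<sigma>. n - 1 \<notin> \<gamma> \<and> n \<notin> \<gamma> \<longrightarrow> proper n c w \<gamma>) \<and>
     orbit \<sigma> (n - 1) \<noteq> orbit \<sigma> n \<and>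
     \<not> proper n c w (orbit \<sigma> (n - 1)) \<and>
     w (orbit \<sigma> n) < (\<Sum>i\<in>orbit \<sigma> n - {n}. c i)}"

definition S4 :: "nat \<Rightarrow> (nat \<Rightarrow> nat) \<Rightarrow> nat \<Rightarrow> nat \<Rightarrow> cowp set" where
  "S4 n c k m =
     (if m > 1 then {(\<sigma>, p, w) \<in> cowps_type n m k.
        orbit \<sigma> (n - 1) = orbit \<sigma> n \<and>
        \<not> proper n c w (orbit \<sigma> n) \<and>
        (\<forall>\<gamma>\<in>cyc n \<sigma>. \<gamma> \<noteq> orbit \<sigma> n \<longrightarrow> proper n c w \<gamma>)}
      else {})"

end

theory Submission
  imports
    Defs
    "HOL-Computational_Algebra.Formal_Power_Series"
begin

text \<open>Both sides become a sum over the subsets \<open>J\<close> of \<open>{1..n}\<close>.  Let \<open>e J\<close> be the sum of the \<open>c i\<close>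
  over \<open>i \<in> J \<inter> {1..n-2}\<close>, plus \<open>1\<close> if \<open>J\<close> meets \<open>{n-1, n}\<close>.  The lattice points of the
  \<open>t\<close>-th dilate are counted by the coefficient of \<open>z^(t k)\<close> in
  \<open>(\<Prod>i\<le>n-2. 1 - z^(t c i + 1)) (1 - (t+2) z^(t+1) + (t+1) z^(t+2)) / (1 - z)^n\<close>, and in the expanded
  numerator \<open>J\<close> contributes \<open>(-1)^|J| (1 + t [n-1 \<in> J]) z^(t e J + |J|)\<close>.
  On the combinatorial side, the Eulerian identity
  \<open>(\<Sum>p. z^des p) = (1 - z)^r (\<Sum>j. j^(r-1) z^j)\<close> turns a cycle with weights below \<open>d\<close> into a factor
  \<open>1 - z^d\<close>, and expanding these products gives signed sums over sets \<open>T\<close> of cycles.  The point of the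
  four sets is that the terms of \<open>S1\<close> and \<open>S2\<close> together, and those of \<open>S3\<close> and \<open>S4\<close> together, depend
  only on \<open>J = \<Union>T\<close>.  Summing over the permutations then yields products of Pochhammer symbols, which
  are the binomial coefficients of the geometric side as polynomials in \<open>t\<close>.\<close>


section \<open>The Eulerian identity\<close>

fun ascents :: "nat list \<Rightarrow> nat" where
  "ascents (x # y # zs) = of_bool (x < y) + ascents (y # zs)"
| "ascents _ = 0"

text \<open>This is the factorization of \<open>b ^ N - a ^ N\<close> with the summation index
  replaced by ranks: along \<open>A\<close> in increasing order the exponent of \<open>b\<close>
  runs up from 0 and that of \<open>a\<close> runs down to 0. In the induction a new maximum
  \<open>m\<close> raises every exponent of \<open>a\<close> by one and leaves those of
  \<open>b\<close> alone.\<close>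

lemma sum_rank_powers:
  fixes a b :: real and A :: "nat set"
  assumes "finite A"
  shows "(b - a) * (\<Sum>y\<in>A. a ^ card {z \<in> A. y < z} * b ^ card {z \<in> A. z < y}) = b ^ card A - a ^ card A"
  using assms
proof (induction rule: finite_linorder_max_induct)
  case empty
  then show ?case by simp
next
  case (insert m A)
  have m: "m \<notin> A" using insert by auto
  have e: "{z \<in> insert m A. m < z} = {}" "{z \<in> insert m A. z < m} = A" using insert by auto
  have hi: "card {z \<in> insert m A. y < z} = Suc (card {z \<in> A. y < z})" if "y \<in> A" for y
  proof -
    have "{z \<in> insert m A. y < z} = insert m {z \<in> A. y < z}" using insert that by auto
    then show ?thesis using insert m by simp
  qed
  have lo: "{z \<in> insert m A. z < y} = {z \<in> A. z < y}" if "y \<in> A" for y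
    using insert that by (auto dest: less_asym)
  have "(\<Sum>y\<in>insert m A. a ^ card {z \<in> insert m A. y < z} * b ^ card {z \<in> insert m A. z < y})
     = b ^ card A + (\<Sum>y\<in>A. a * (a ^ card {z \<in> A. y < z} * b ^ card {z \<in> A. z < y}))"
    unfolding sum.insert[OF insert.hyps(1) m] e by (intro arg_cong2[of _ _ _ _ plus] sum.cong) (simp_all add: hi lo mult.assoc del: insert_iff)
  also have "\<dots> = b ^ card A + a * (\<Sum>y\<in>A. a ^ card {z \<in> A. y < z} * b ^ card {z \<in> A. z < y})"
    by (simp add: sum_distrib_left)
  finally have "(b - a) * (\<Sum>y\<in>insert m A. a ^ card {z \<in> insert m A. y < z} * b ^ card {z \<in> insert m A. z < y})
     = (b - a) * b ^ card A + a * ((b - a) * (\<Sum>y\<in>A. a ^ card {z \<in> A. y < z} * b ^ card {z \<in> A. z < y}))"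
    by (simp only:) (simp add: algebra_simps)
  then show ?case using insert m by (simp only: insert.IH) (simp add: algebra_simps)
qed

lemma one_minus_X_times_nth:
  fixes F :: "real fps"
  shows "fps_nth ((1 - fps_X) * F) j = fps_nth F j - (if j = 0 then 0 else fps_nth F (j - 1))"
  by (simp add: left_diff_distrib)

text \<open>The Eulerian identity refined by the first letter \<open>x\<close>: the exponents are the numbers of
  letters above and below \<open>x\<close>, which makes the recursion on the second letter telescope.\<close>

lemma sum_ascents_Cons:
  fixes A :: "nat set"
  assumes "finite A" "x \<in> A"
  shows "(\<Sum>ys\<in>permutations_of_set (A - {x}). (fps_X :: real fps) ^ ascents (x # ys)) =
    (1 - fps_X) ^ card A *
      Abs_fps (\<lambda>j. real j ^ card {a \<in> A. x < a} * (real j + 1) ^ card {a \<in> A. a < x})"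
  using assms
proof (induction "card A" arbitrary: A x rule: less_induct)
  case less
  define B where "B = A - {x}"
  have B: "finite B" "x \<notin> B" "A = insert x B" "card A = Suc (card B)"
    using less.prems by (auto simp: B_def card_Suc_Diff1 simp del: card_Diff_insert)
  have AB: "{a \<in> A. x < a} = {a \<in> B. x < a}" "{a \<in> A. a < x} = {a \<in> B. a < x}"
    using B by auto
  show ?case
  proof (cases "B = {}")
    case True
    have "Abs_fps (\<lambda>j. 1) * (1 - fps_X) = (1::real fps)"
      by (rule fps_ext) (subst mult.commute, subst one_minus_X_times_nth, auto)
    moreover have "A = {x}" using True B by simp
    ultimately show ?thesis unfolding AB True by (simp add: mult.commute)
  next
    case False
    \<comment> \<open>The second letter \<open>y\<close> is either in \<open>L\<close>, with no
      ascent at the first step, or in \<open>U\<close>, where the ascent contributes a factor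
      \<open>fps_X\<close> and so shifts the coefficient from \<open>j\<close> to
      \<open>j - 1\<close>.\<close>
    define L U where "L = {a \<in> B. a < x}" and "U = {a \<in> B. x < a}"
    have LU: "finite L" "finite U" "L \<inter> U = {}"
      using B by (auto simp: L_def U_def)
    have LU4: "B = L \<union> U"
      using B(2) by (auto simp: L_def U_def) (metis linorder_neqE_nat)
    have cLU: "card L + card U = card B" using LU LU4 by (simp add: card_Un_disjoint)
    let ?f = "\<lambda>y. Abs_fps (\<lambda>j. real j ^ card {a \<in> B. y < a} * (real j + 1) ^ card {a \<in> B. a < y})"
    have "(\<Sum>ys\<in>permutations_of_set B. (fps_X :: real fps) ^ ascents (x # ys))
       = (\<Sum>y\<in>B. \<Sum>zs\<in>permutations_of_set (B - {y}). fps_X ^ ascents (x # y # zs))"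
      using False B
      by (subst permutations_of_set_nonempty, simp, subst sum.UNION_disjoint)
         (auto simp: sum.reindex inj_on_def)
    also have "\<dots> = (\<Sum>y\<in>B. fps_X ^ of_bool (x < y) * ((1 - fps_X) ^ card B * ?f y))"
    proof (rule sum.cong)
      fix y assume y: "y \<in> B"
      show "(\<Sum>zs\<in>permutations_of_set (B - {y}). (fps_X :: real fps) ^ ascents (x # y # zs))
         = fps_X ^ of_bool (x < y) * ((1 - fps_X) ^ card B * ?f y)"
        using less.hyps[of B y] B y by (simp add: power_add sum_distrib_left[symmetric])
    qed simp
    also have "\<dots> = (1 - fps_X) ^ card B * (\<Sum>y\<in>B. fps_X ^ of_bool (x < y) * ?f y)"
      by (simp add: sum_distrib_left mult_ac)
    also have "(\<Sum>y\<in>B. fps_X ^ of_bool (x < y) * ?f y) = (1 - fps_X) *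
        Abs_fps (\<lambda>j. real j ^ card U * (real j + 1) ^ card L)"
    proof (rule fps_ext)
      fix j
      have "fps_nth (\<Sum>y\<in>B. fps_X ^ of_bool (x < y) * ?f y) j
         = (\<Sum>y\<in>L. fps_nth (?f y) j) + (\<Sum>y\<in>U. if j = 0 then 0 else fps_nth (?f y) (j - 1))"
      proof -
        have "fps_nth (\<Sum>y\<in>B. fps_X ^ of_bool (x < y) * ?f y) j
         = (\<Sum>y\<in>L. fps_nth (fps_X ^ of_bool (x < y) * ?f y) j) + (\<Sum>y\<in>U. fps_nth (fps_X ^ of_bool (x < y) * ?f y) j)"
          unfolding fps_sum_nth LU4 using LU by (intro sum.union_disjoint) auto
        also have "(\<Sum>y\<in>L. fps_nth (fps_X ^ of_bool (x < y) * ?f y) j) = (\<Sum>y\<in>L. fps_nth (?f y) j)"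
          by (rule sum.cong) (auto simp: L_def)
        also have "(\<Sum>y\<in>U. fps_nth (fps_X ^ of_bool (x < y) * ?f y) j) = (\<Sum>y\<in>U. if j = 0 then 0 else fps_nth (?f y) (j - 1))"
          by (rule sum.cong) (auto simp: U_def)
        finally show ?thesis .
      qed
      \<comment> \<open>All of \<open>U\<close> lies above each \<open>y \<in> L\<close>, so
        \<open>j ^ card U\<close> factors out. The remaining sum is that of
        \<open>sum_rank_powers\<close> with bases \<open>j\<close> and \<open>j + 1\<close>, whose
        difference is 1.\<close>
      also have "(\<Sum>y\<in>L. fps_nth (?f y) j)
         = real j ^ card U * (\<Sum>y\<in>L. real j ^ card {a \<in> L. y < a} * (real j + 1) ^ card {a \<in> L. a < y})"
      proof -
        have "fps_nth (?f y) j = real j ^ card U * (real j ^ card {a \<in> L. y < a} * (real j + 1) ^ card {a \<in> L. a < y})"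
          if "y \<in> L" for y
        proof -
          have "{a \<in> B. a < y} = {a \<in> L. a < y}" using that by (auto simp: L_def)
          moreover have "{a \<in> B. y < a} = {a \<in> L. y < a} \<union> U"
            using that B(2) by (auto simp: L_def U_def) (metis linorder_neqE_nat)
          moreover have "card ({a \<in> L. y < a} \<union> U) = card {a \<in> L. y < a} + card U"
            using LU by (intro card_Un_disjoint) auto
          ultimately show ?thesis by (simp add: power_add mult_ac)
        qed
        then show ?thesis by (simp add: sum_distrib_left)
      qed
      also have "\<dots> = real j ^ card U * ((real j + 1) ^ card L - real j ^ card L)"
        using sum_rank_powers[OF LU(1), of "real j + 1" "real j"] by simp
      \<comment> \<open>Dually, all of \<open>L\<close> lies below each \<open>y \<in> U\<close>;
        because of the shift the bases are now \<open>j - 1\<close> and \<open>j\<close>.\<close>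
      also have "(\<Sum>y\<in>U. if j = 0 then 0 else fps_nth (?f y) (j - 1))
         = (if j = 0 then 0 else real j ^ card L * (real j ^ card U - (real j - 1) ^ card U))"
      proof (cases "j = 0")
        case False
        have "fps_nth (?f y) (j - 1) = real j ^ card L * ((real j - 1) ^ card {a \<in> U. y < a} * real j ^ card {a \<in> U. a < y})"
          if "y \<in> U" for y
        proof -
          have "{a \<in> B. y < a} = {a \<in> U. y < a}" using that by (auto simp: U_def)
          moreover have "{a \<in> B. a < y} = {a \<in> U. a < y} \<union> L"
            using that B(2) by (auto simp: L_def U_def) (metis linorder_neqE_nat)
          moreover have "card ({a \<in> U. a < y} \<union> L) = card {a \<in> U. a < y} + card L"
            using LU by (intro card_Un_disjoint) auto
          ultimately show ?thesis using False by (simp add: power_add mult_ac of_nat_diff)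
        qed
        then have "(\<Sum>y\<in>U. if j = 0 then 0 else fps_nth (?f y) (j - 1)) = real j ^ card L *
            (\<Sum>y\<in>U. (real j - 1) ^ card {a \<in> U. y < a} * real j ^ card {a \<in> U. a < y})"
          using False by (simp add: sum_distrib_left)
        also have "\<dots> = real j ^ card L * (real j ^ card U - (real j - 1) ^ card U)"
          using sum_rank_powers[OF LU(2), of "real j" "real j - 1"] by simp
        finally show ?thesis using False by simp
      qed simp
      also have "real j ^ card U * ((real j + 1) ^ card L - real j ^ card L) +
         (if j = 0 then 0 else real j ^ card L * (real j ^ card U - (real j - 1) ^ card U))
        = fps_nth ((1 - fps_X) * Abs_fps (\<lambda>j. real j ^ card U * (real j + 1) ^ card L)) j"
      proof (cases "j = 0")
        case True
        \<comment> \<open>At \<open>j = 0\<close> there is no term from \<open>U\<close> to cancel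
          \<open>0 ^ card U * 0 ^ card L\<close>. This product vanishes because \<open>B\<close> is
          nonempty, so that one of the exponents is positive.\<close>
        moreover have "(0::real) ^ card U * 0 ^ card L = 0"
          using cLU \<open>B \<noteq> {}\<close> B(1) by (auto simp: power_0_left)
        ultimately show ?thesis
          unfolding one_minus_X_times_nth by (simp add: right_diff_distrib)
      next
        case False
        then show ?thesis
          unfolding one_minus_X_times_nth by (simp add: algebra_simps of_nat_diff)
      qed
      finally show "fps_nth (\<Sum>y\<in>B. fps_X ^ of_bool (x < y) * ?f y) j = fps_nth ((1 - fps_X) *
        Abs_fps (\<lambda>j. real j ^ card U * (real j + 1) ^ card L)) j" .
    qed
    finally show ?thesis
      unfolding AB B_def[symmetric] L_def[symmetric] U_def[symmetric] B(4) by (simp add: mult_ac)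
  qed
qed

text \<open>Reading \<open>p\<close> backwards turns descents into ascents and moves the prescribed
  value \<open>p r\<close> to the front, where \<open>sum_ascents_Cons\<close> can use it.\<close>

lemma ascents_rev_word: "ascents (map p (rev [1..<Suc r])) = des r p"
proof (induction r)
  case 0
  then show ?case by (simp add: des_def)
next
  case (Suc r)
  show ?case
  proof (cases r)
    case 0
    have "{i. 1 \<le> i \<and> i < Suc 0 \<and> p (Suc i) < p i} = {}" by auto
    then show ?thesis using 0 by (simp add: des_def)
  next
    case (Suc s)
    have "{i. 1 \<le> i \<and> i < Suc r \<and> p i > p (i + 1)} = {i. 1 \<le> i \<and> i < r \<and> p i > p (i + 1)} \<union> (if p r > p (r + 1) then {r} else {})"
      using Suc by (auto simp: less_Suc_eq)
    moreover have "card ({i. 1 \<le> i \<and> i < r \<and> p i > p (i + 1)} \<union> (if p r > p (r + 1) then {r} else {})) =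
       of_bool (p (Suc r) < p r) + des r p"
      by (subst card_Un_disjoint) (auto simp: des_def)
    ultimately have "des (Suc r) p = of_bool (p (Suc r) < p r) + des r p" by (simp add: des_def)
    then show ?thesis using Suc.IH Suc by simp
  qed
qed

text \<open>The reversed word starts with 1, which has no letters below it and \<open>r - 1\<close>
  above it, so the refined identity leaves just \<open>j ^ (r - 1)\<close>. For \<open>r = 1\<close>
  the coefficient at \<open>j = 0\<close> is \<open>0 ^ 0 = 1\<close>.\<close>

lemma eulerian_series:
  assumes "r > 0"
  shows "(\<Sum>p | p permutes {1..r} \<and> p r = 1. (fps_X :: real fps) ^ des r p) =
    (1 - fps_X) ^ r * Abs_fps (\<lambda>j. real j ^ (r - 1))"
proof -
  let ?w = "\<lambda>p. map p (rev [1..<Suc r])"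
  have w: "?w p = p r # map p (rev [1..<r])" for p :: "nat \<Rightarrow> nat"
    using assms by (cases r) auto
  have "bij_betw (\<lambda>p. map p (rev [1..<r])) {p. p permutes {1..r} \<and> p r = 1} (permutations_of_set ({1..r} - {1}))"
  proof (rule bij_betwI')
    fix p q assume pq: "p \<in> {p. p permutes {1..r} \<and> p r = 1}" "q \<in> {p. p permutes {1..r} \<and> p r = 1}"
    show "(map p (rev [1..<r]) = map q (rev [1..<r])) = (p = q)"
    proof
      assume *: "map p (rev [1..<r]) = map q (rev [1..<r])"
      show "p = q"
      proof
        fix i
        consider "i \<in> {1..<r}" | "i = r" | "i \<notin> {1..r}" by fastforce
        then show "p i = q i"
        proof cases
          case 1
          then show ?thesis using * by (auto simp: map_eq_conv)
        qed (use pq in \<open>auto simp: permutes_not_in\<close>)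
      qed
    qed auto
  next
    fix p assume p: "p \<in> {p. p permutes {1..r} \<and> p r = 1}"
    have inj: "inj p" using p permutes_inj by blast
    have "p ` {1..<r} = p ` ({1..r} - {r})" by (rule arg_cong[of _ _ "image p"]) (use assms in auto)
    also have "\<dots> = {1..r} - {1}"
      using p inj by (auto simp: image_set_diff permutes_image)
    finally show "map p (rev [1..<r]) \<in> permutations_of_set ({1..r} - {1})"
      using inj by (auto simp: permutations_of_set_def distinct_map inj_on_def inj_def)
  next
    fix ys assume ys: "ys \<in> permutations_of_set ({1..r} - {1})"
    have d: "set ys = {1..r} - {1}" "distinct ys"
      using ys by (simp_all only: permutations_of_set_def mem_Collect_eq)
    have "length ys = card ({1..r} - {1})" using d distinct_card by metis
    also have "\<dots> = r - 1" using assms by simp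
    finally have len: "length ys = r - 1" .
    define xs where "xs = 1 # ys"
    have "1 \<notin> set ys" "insert 1 (set ys) = {1..r}" unfolding d(1) using assms by auto
    then have xs: "distinct xs" "set xs = {1..r}" "length xs = r"
      using d(2) len assms by (simp_all add: xs_def)
    \<comment> \<open>The preimage of \<open>ys\<close> places the word \<open>1 # ys\<close> from
      position \<open>r\<close> down to position 1.\<close>
    define p where "p = (\<lambda>i. if i \<in> {1..r} then xs ! (r - i) else i)"
    have "bij_betw (\<lambda>i. r - i) {1..r} {..<r}"
      by (rule bij_betwI[where g = "\<lambda>i. r - i"]) (use assms in auto)
    then have "bij_betw ((!) xs \<circ> (\<lambda>i. r - i)) {1..r} {1..r}"
      using bij_betw_nth[OF xs(1), of "{..<r}" "{1..r}"] xs by (auto intro: bij_betw_trans)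
    then have "bij_betw p {1..r} {1..r}"
      by (rule bij_betw_cong[THEN iffD1, rotated]) (auto simp: p_def)
    then have "p permutes {1..r}" by (rule bij_imp_permutes) (auto simp: p_def)
    moreover have "p r = 1" using assms by (auto simp: p_def xs_def)
    moreover have "ys = map p (rev [1..<r])"
    proof (rule nth_equalityI)
      show "length ys = length (map p (rev [1..<r]))" using len by simp
      fix i assume i: "i < length ys"
      then have *: "rev [1..<r] ! i = r - 1 - i" using len by (simp add: rev_nth)
      then show "ys ! i = map p (rev [1..<r]) ! i"
        using i len by (auto simp: p_def xs_def nth_Cons' )
    qed
    ultimately show "\<exists>p\<in>{p. p permutes {1..r} \<and> p r = 1}. ys = map p (rev [1..<r])" by auto
  qed
  then have "(\<Sum>p | p permutes {1..r} \<and> p r = 1. (fps_X :: real fps) ^ ascents (1 # map p (rev [1..<r])))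
     = (\<Sum>ys\<in>permutations_of_set ({1..r} - {1}). (fps_X :: real fps) ^ ascents (1 # ys))"
    by (rule sum.reindex_bij_betw)
  also have "(\<Sum>p | p permutes {1..r} \<and> p r = 1. (fps_X :: real fps) ^ ascents (1 # map p (rev [1..<r])))
     = (\<Sum>p | p permutes {1..r} \<and> p r = 1. (fps_X :: real fps) ^ des r p)"
    by (rule sum.cong) (simp_all only: ascents_rev_word[symmetric] w mem_Collect_eq)
  also have "(\<Sum>ys\<in>permutations_of_set ({1..r} - {1}). (fps_X :: real fps) ^ ascents (1 # ys))
     = (1 - fps_X) ^ r * Abs_fps (\<lambda>j. real j ^ (r - 1))"
  proof -
    have c: "card {a \<in> {1..r}. a < 1} = 0" "card {a \<in> {1..r}. 1 < a} = r - 1"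
    proof -
      have "{a \<in> {1..r}. a < 1} = {}" "{a \<in> {1..r}. 1 < a} = {2..r}" by auto
      then show "card {a \<in> {1..r}. a < 1} = 0" "card {a \<in> {1..r}. 1 < a} = r - 1"
        by (simp_all only: card.empty card_atLeastAtMost)
    qed
    have "finite {1..r}" "1 \<in> {1..r}" using assms by auto
    from sum_ascents_Cons[OF this] show ?thesis by (simp only: c card_atLeastAtMost power_0 mult_1_right diff_Suc_1)
  qed
  finally show ?thesis .
qed


section \<open>Signed sums over sets of cycles\<close>

text \<open>Composing with \<open>transpose a b\<close> inserts the new point \<open>a\<close> into
  the cycle of \<open>b\<close> directly before \<open>b\<close>: the predecessor of
  \<open>b\<close> is sent to \<open>a\<close>, the point \<open>a\<close>, fixed by
  \<open>q\<close>, is sent to \<open>b\<close>, and all other arrows stay.\<close>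

lemma orbit_transpose_comp:
  assumes q: "q permutes A" and a: "a \<notin> A" and b: "b \<in> A" and x: "x \<in> A"
  shows "orbit (transpose a b \<circ> q) x = (if b \<in> orbit q x then insert a (orbit q x) else orbit q x)"
proof -
  let ?s = "transpose a b \<circ> q"
  have qA: "q z \<in> A \<longleftrightarrow> z \<in> A" for z using q by (rule permutes_in_image)
  have sb: "?s z = a" if "q z = b" for z using that by simp
  have sa: "?s a = b" using q a by (simp add: permutes_not_in)
  have sn: "?s z = q z" if "z \<in> A" "q z \<noteq> b" for z
    using that qA[of z] a by (auto simp: transpose_def)
  have sub: "orbit q x \<subseteq> A" using q x by (rule permutes_orbit_subset)
  have 1: "z \<in> orbit ?s x" if "z \<in> orbit q x" for z
    using that
  proof induction
    case base
    show ?case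
    proof (cases "q x = b")
      case True
      then have "a \<in> orbit ?s x" using sb orbit.base[of ?s x] by metis
      then show ?thesis using sa orbit.step[of a ?s x] True by metis
    next
      case False
      then show ?thesis using sn x orbit.base[of ?s x] by metis
    qed
  next
    case (step y)
    show ?case
    proof (cases "q y = b")
      case True
      then have "a \<in> orbit ?s x" using sb orbit.step[OF step.IH] by metis
      then show ?thesis using sa orbit.step[of a ?s x] True by metis
    next
      case False
      then show ?thesis using sn sub step.hyps orbit.step[OF step.IH] by (metis subsetD)
    qed
  qed
  have 2: "a \<in> orbit ?s x" if "b \<in> orbit q x"
    using that
  proof cases
    case base
    then show ?thesis using sb orbit.base[of ?s x] by metis
  next
    case (step y)
    then show ?thesis using sb orbit.step[OF 1, of y] by metis
  qed
  have 3: "z \<in> orbit q x \<or> z = a \<and> b \<in> orbit q x" if "z \<in> orbit ?s x" for z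
    using that
  proof induction
    case base
    show ?case
      using sb[of x] sn[OF x] orbit.base[of q x] by metis
  next
    case (step y)
    show ?case
    proof (cases "y = a")
      case True
      then show ?thesis using step.IH sa sub a by auto
    next
      case False
      then have "y \<in> orbit q x" using step.IH by simp
      then show ?thesis using sb[of y] sn[of y] orbit.step[of y q x] sub by (metis subsetD)
    qed
  qed
  show ?thesis using 1 2 3 by auto
qed

lemma orbit_image_transpose_comp:
  assumes fin: "finite A" and q: "q permutes A" and a: "a \<notin> A" and b: "b \<in> A"
  shows "orbit (transpose a b \<circ> q) ` insert a A =
    (\<lambda>\<gamma>. if b \<in> \<gamma> then insert a \<gamma> else \<gamma>) ` orbit q ` A"
proof -
  let ?s = "transpose a b \<circ> q"
  have "q permutes insert a A" using q by (rule permutes_subset) auto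
  moreover have "transpose a b permutes insert a A" using b by (intro permutes_swap_id) auto
  ultimately have s: "?s permutes insert a A" by (rule permutes_compose)
  then have ps: "permutation ?s" using fin by (auto simp: permutation_permutes)
  have "?s a = b" using q a by (simp add: permutes_not_in)
  then have "orbit ?s a = orbit ?s b" using permutation_orbit_step[OF ps, of a] by simp
  then have "orbit ?s ` insert a A = orbit ?s ` A" using b by auto
  also have "\<dots> = (\<lambda>\<gamma>. if b \<in> \<gamma> then insert a \<gamma> else \<gamma>) ` orbit q ` A"
    unfolding image_image by (rule image_cong) (use orbit_transpose_comp[OF q a b] in auto)
  finally show ?thesis .
qed

lemma Union_orbits:
  assumes "finite A" "q permutes A"
  shows "\<Union>(orbit q ` A) = A"
proof -
  have "permutation q" using assms by (auto simp: permutation_permutes)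
  then show ?thesis
    using permutes_orbit_subset[OF assms(2)] permutation_self_in_orbit[of q] by blast
qed

lemma sum_Pow_insert:
  assumes "finite A" "a \<notin> A"
  shows "sum f (Pow (insert a A)) = sum f (Pow A) + (\<Sum>T\<in>Pow A. f (insert a T))"
proof -
  have "inj_on (insert a) (Pow A)" using assms by (auto simp: inj_on_def)
  moreover have "Pow A \<inter> insert a ` Pow A = {}" using assms by auto
  ultimately show ?thesis
    using assms by (simp add: Pow_insert sum.union_disjoint sum.reindex)
qed

text \<open>Choosing a permutation of \<open>A\<close> and a set \<open>T\<close> of its cycles amounts to choosing permutations
  of \<open>\<Union>T\<close> and of its complement; the cycle enumerators of the two are Pochhammer symbols.\<close>

lemma sum_signed_cycle_sets:
  fixes y :: "'r :: comm_ring_1"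
  assumes "finite A"
  shows "(\<Sum>q | q permutes A. \<Sum>T\<in>Pow (orbit q ` A). (-1) ^ card T * y ^ card (orbit q ` A) * g (\<Union>T)) =
    (\<Sum>J\<in>Pow A. pochhammer (-y) (card J) * pochhammer y (card (A - J)) * g J)"
  using assms
proof (induction A arbitrary: g)
  case empty
  then show ?case by simp
next
  case (insert a A)
  \<comment> \<open>Each permutation of \<open>insert a A\<close> is
    \<open>transpose a b \<circ> q\<close>, where \<open>a\<close> becomes a fixed point if
    \<open>b = a\<close> and is inserted before \<open>b\<close> otherwise. A new cycle
    \<open>{a}\<close> costs a factor \<open>y\<close>, with a minus sign if it is chosen; the
    \<open>card J\<close> places inside \<open>J = \<Union>T\<close> put \<open>a\<close> into the
    chosen part, and the \<open>card (A - J)\<close> other places do not. The two coefficients in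
    \<open>h\<close> are the last factors of the Pochhammer symbols lengthened by one.\<close>
  define h where "h J = (of_nat (card J) - y) * g (insert a J) + (y + of_nat (card (A - J))) * g J" for J
  let ?S = "\<lambda>s B. \<Sum>T\<in>Pow (orbit s ` B). (-1) ^ card T * y ^ card (orbit s ` B) * g (\<Union>T)"
  have *: "(\<Sum>b\<in>insert a A. ?S (transpose a b \<circ> q) (insert a A)) =
      (\<Sum>T\<in>Pow (orbit q ` A). (-1) ^ card T * y ^ card (orbit q ` A) * h (\<Union>T))"
    if q: "q permutes A" for q
  proof -
    define C where "C = orbit q ` A"
    have C: "finite C" "\<Union>C = A" using insert.hyps q by (auto simp: C_def Union_orbits)
    have fT: "finite T" if "T \<in> Pow C" for T using that C(1) by (auto intro: finite_subset)
    have aC: "{a} \<notin> C" "a \<notin> \<Union>T" if "T \<in> Pow C" for T using C insert.hyps that by auto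
    have "orbit q a = {a}" using q insert.hyps by (simp add: orbit_eq_singleton_iff permutes_not_in)
    then have oa: "orbit q ` insert a A = insert {a} C" by (simp add: C_def)
    have A: "?S (transpose a a \<circ> q) (insert a A) =
       (\<Sum>T\<in>Pow C. (-1) ^ card T * y ^ card C * (y * g (\<Union>T) - y * g (insert a (\<Union>T))))"
      (is "_ = ?RA")
    proof -
      have "?S (transpose a a \<circ> q) (insert a A) =
        (\<Sum>T\<in>Pow (insert {a} C). (-1) ^ card T * y ^ card (insert {a} C) * g (\<Union>T))"
        by (simp only: transpose_same id_comp oa)
      also have "\<dots> = (\<Sum>T\<in>Pow C. (-1) ^ card T * y ^ Suc (card C) * g (\<Union>T)) +
         (\<Sum>T\<in>Pow C. (-1) ^ Suc (card T) * y ^ Suc (card C) * g (insert a (\<Union>T)))"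
      proof (subst sum_Pow_insert)
        show "finite C" "{a} \<notin> C" using C aC by auto
        have "card (insert {a} T) = Suc (card T)" if "T \<in> Pow C" for T
          using that fT aC by (subst card_insert_disjoint) auto
        moreover have "card (insert {a} C) = Suc (card C)"
          using C aC by (subst card_insert_disjoint) auto
        ultimately show "(\<Sum>T\<in>Pow C. (-1) ^ card T * y ^ card (insert {a} C) * g (\<Union>T)) +
           (\<Sum>T\<in>Pow C. (-1) ^ card (insert {a} T) * y ^ card (insert {a} C) * g (\<Union>(insert {a} T)))
          = (\<Sum>T\<in>Pow C. (-1) ^ card T * y ^ Suc (card C) * g (\<Union>T)) +
         (\<Sum>T\<in>Pow C. (-1) ^ Suc (card T) * y ^ Suc (card C) * g (insert a (\<Union>T)))"
          by simp
      qed
      also have "\<dots> = ?RA" by (simp add: sum.distrib[symmetric] algebra_simps)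
      finally show ?thesis .
    qed
    have Bb: "?S (transpose a b \<circ> q) (insert a A) =
       (\<Sum>T\<in>Pow C. (-1) ^ card T * y ^ card C * (if b \<in> \<Union>T then g (insert a (\<Union>T)) else g (\<Union>T)))"
      if b: "b \<in> A" for b
    proof -
      \<comment> \<open>\<open>u\<close> matches the cycles of \<open>q\<close> with those of the
        enlarged permutation, so the chosen sets of cycles correspond, with equal sizes, and only
        their unions change.\<close>
      define u where "u = (\<lambda>\<gamma>. if b \<in> \<gamma> then insert a \<gamma> else \<gamma>)"
      have "inj_on u C"
        using aC[of "C"] C insert.hyps by (intro inj_onI) (auto simp: u_def split: if_splits)
      then have inj: "inj_on (image u) (Pow C)" "card (u ` T) = card T" if "T \<in> Pow C" for T
        using that by (auto intro!: inj_on_image_Pow card_image intro: inj_on_subset)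
      have un: "\<Union>(u ` T) = (if b \<in> \<Union>T then insert a (\<Union>T) else \<Union>T)" for T
        by (auto simp: u_def split: if_splits)
      show ?thesis
        unfolding orbit_image_transpose_comp[OF insert.hyps(1) q insert.hyps(2) b] C_def[symmetric] u_def[symmetric]
          image_Pow_surj[OF refl, symmetric]
        using inj by (subst sum.reindex) (auto simp: un inj(2)[of C] intro!: sum.cong)
    qed
    have BB: "(\<Sum>b\<in>A. ?S (transpose a b \<circ> q) (insert a A)) =
      (\<Sum>T\<in>Pow C. (-1) ^ card T * y ^ card C *
         (of_nat (card (\<Union>T)) * g (insert a (\<Union>T)) + of_nat (card (A - \<Union>T)) * g (\<Union>T)))"
    proof -
      have "(\<Sum>b\<in>A. ?S (transpose a b \<circ> q) (insert a A)) = (\<Sum>b\<in>A.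
        \<Sum>T\<in>Pow C. (-1) ^ card T * y ^ card C * (if b \<in> \<Union>T then g (insert a (\<Union>T)) else g (\<Union>T)))"
        by (rule sum.cong) (simp_all only: Bb)
      also have "\<dots> = (\<Sum>T\<in>Pow C. \<Sum>b\<in>A. (-1) ^ card T * y ^ card C *
          (if b \<in> \<Union>T then g (insert a (\<Union>T)) else g (\<Union>T)))"
        by (rule sum.swap)
      also have "\<dots> = (\<Sum>T\<in>Pow C. (-1) ^ card T * y ^ card C *
         (of_nat (card (\<Union>T)) * g (insert a (\<Union>T)) + of_nat (card (A - \<Union>T)) * g (\<Union>T)))"
      proof (rule sum.cong)
        fix T assume T: "T \<in> Pow C"
        have "(\<Sum>b\<in>A. if b \<in> \<Union>T then g (insert a (\<Union>T)) else g (\<Union>T)) =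
          (\<Sum>b\<in>\<Union>T. g (insert a (\<Union>T))) + (\<Sum>b\<in>A - \<Union>T. g (\<Union>T))"
        proof -
          have "A \<inter> \<Union>T = \<Union>T" "A \<inter> - \<Union>T = A - \<Union>T" using T C by auto
          then show ?thesis using insert.hyps(1)
            by (simp only: sum.If_cases[of A "\<lambda>b. b \<in> \<Union>T"] Collect_mem_eq)
        qed
        then show "(\<Sum>b\<in>A. (-1) ^ card T * y ^ card C * (if b \<in> \<Union>T then g (insert a (\<Union>T)) else g (\<Union>T))) =
           (-1) ^ card T * y ^ card C *
         (of_nat (card (\<Union>T)) * g (insert a (\<Union>T)) + of_nat (card (A - \<Union>T)) * g (\<Union>T))"
          by (simp only: sum_distrib_left[symmetric] sum_constant)
      qed simp
      finally show ?thesis .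
    qed
    have "(\<Sum>b\<in>insert a A. ?S (transpose a b \<circ> q) (insert a A)) =
       ?S (transpose a a \<circ> q) (insert a A) + (\<Sum>b\<in>A. ?S (transpose a b \<circ> q) (insert a A))"
      by (rule sum.insert[OF insert.hyps])
    also have "\<dots> = (\<Sum>T\<in>Pow C. (-1) ^ card T * y ^ card C * h (\<Union>T))"
      unfolding A BB by (simp add: h_def sum.distrib[symmetric] algebra_simps)
    finally show ?thesis unfolding C_def .
  qed
  have "(\<Sum>q | q permutes insert a A. ?S q (insert a A)) =
    (\<Sum>b\<in>insert a A. \<Sum>q | q permutes A. ?S (transpose a b \<circ> q) (insert a A))"
    by (rule sum_over_permutations_insert[OF insert.hyps])
  also have "\<dots> = (\<Sum>q | q permutes A. \<Sum>b\<in>insert a A. ?S (transpose a b \<circ> q) (insert a A))"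
    by (rule sum.swap)
  also have "\<dots> = (\<Sum>q | q permutes A. \<Sum>T\<in>Pow (orbit q ` A). (-1) ^ card T * y ^ card (orbit q ` A) * h (\<Union>T))"
    by (rule sum.cong) (simp_all only: * mem_Collect_eq)
  also have "\<dots> = (\<Sum>J\<in>Pow A. pochhammer (-y) (card J) * pochhammer y (card (A - J)) * h J)"
    by (rule insert.IH)
  also have "\<dots> = (\<Sum>J\<in>Pow A. pochhammer (-y) (card J) * pochhammer y (card (insert a A - J)) * g J)
     + (\<Sum>J\<in>Pow A. pochhammer (-y) (card (insert a J)) * pochhammer y (card (insert a A - insert a J)) * g (insert a J))"
  proof -
    have "card (insert a J) = Suc (card J)" "insert a A - insert a J = A - J"
      "card (insert a A - J) = Suc (card (A - J))" if "J \<in> Pow A" for J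
    proof -
      have "finite J" "a \<notin> J" using that insert.hyps by (auto intro: finite_subset)
      then show "card (insert a J) = Suc (card J)" "insert a A - insert a J = A - J"
        "card (insert a A - J) = Suc (card (A - J))"
        using insert.hyps by (auto simp: insert_Diff_if)
    qed
    then show ?thesis
      by (subst sum.distrib[symmetric], intro sum.cong)
        (auto simp: h_def pochhammer_Suc algebra_simps)
  qed
  also have "\<dots> = (\<Sum>J\<in>Pow (insert a A). pochhammer (-y) (card J) * pochhammer y (card (insert a A - J)) * g J)"
    by (rule sum_Pow_insert[symmetric, OF insert.hyps])
  finally show ?case .
qed


section \<open>Weightings of the cycles\<close>

abbreviation indicator_fps :: "nat set \<Rightarrow> real fps" where
  "indicator_fps U \<equiv> Abs_fps (\<lambda>j. of_bool (j \<in> U))"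

lemma one_minus_X_indicator_lessThan: "(1 - fps_X) * indicator_fps {..<d} = 1 - fps_X ^ d"
  by (rule fps_ext) (subst one_minus_X_times_nth, auto)

lemma one_minus_X_indicator_atLeast: "(1 - fps_X) * indicator_fps {d..} = fps_X ^ d"
  by (rule fps_ext) (subst one_minus_X_times_nth, auto)

lemma indicator_fps_singleton: "indicator_fps {d} = fps_X ^ d"
  by (rule fps_ext) auto

lemma one_minus_X_indicator_UNIV: "(1 - fps_X) * indicator_fps UNIV = 1"
  by (rule fps_ext) (subst one_minus_X_times_nth, auto)

lemma finite_PiE_sum_eq:
  assumes "finite C"
  shows "finite {w \<in> PiE C U. sum w C = (k :: nat)}"
proof (rule finite_subset)
  show "{w \<in> PiE C U. sum w C = k} \<subseteq> PiE C (\<lambda>_. {..k})"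
    using assms by (auto simp: PiE_iff extensional_def intro: member_le_sum)
  show "finite (PiE C (\<lambda>_. {..k}))" using assms by (intro finite_PiE) auto
qed

lemma prod_indicator_fps_nth:
  assumes "finite C"
  shows "fps_nth (\<Prod>\<gamma>\<in>C. indicator_fps (U \<gamma>)) k = real (card {w \<in> PiE C U. sum w C = k})"
  using assms
proof (induction C arbitrary: k)
  case empty
  have "{w. (w :: 'a \<Rightarrow> nat) = (\<lambda>x. undefined) \<and> (0 :: nat) = k} = (if k = 0 then {\<lambda>x. undefined} else {})"
    by auto
  then show ?case by simp
next
  case (insert a C)
  let ?W = "\<lambda>k. {w \<in> PiE C U. sum w C = k}"
  have eq: "{w \<in> PiE (insert a C) U. sum w (insert a C) = k} =
      (\<lambda>(i, w). w(a := i)) ` (SIGMA i:{i \<in> {0..k}. i \<in> U a}. ?W (k - i))" (is "?L = ?R")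
  proof (intro equalityI subsetI)
    fix w assume w: "w \<in> ?L"
    then have s: "w a + sum w C = k" using insert by simp
    have "restrict w C \<in> ?W (k - w a)"
      using w s by (auto simp: PiE_iff)
    moreover have "w = (restrict w C)(a := w a)"
      using w by (auto simp: PiE_iff extensional_def restrict_def)
    ultimately show "w \<in> ?R"
      using w s by (intro image_eqI[of _ _ "(w a, restrict w C)"]) (auto simp: PiE_iff)
  next
    fix w assume "w \<in> ?R"
    then obtain i v where iv: "w = v(a := i)" "i \<le> k" "i \<in> U a" "v \<in> PiE C U" "sum v C = k - i"
      by auto
    have "sum w C = sum v C" using iv insert by (intro sum.cong) auto
    then show "w \<in> ?L" using iv insert by (auto simp: PiE_iff extensional_def)
  qed
  have inj: "inj_on (\<lambda>(i, w). w(a := i)) (SIGMA i:{i \<in> {0..k}. i \<in> U a}. ?W (k - i))"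
  proof (rule inj_onI, clarsimp)
    fix i v j w assume *: "v \<in> PiE C U" "w \<in> PiE C U" "v(a := i) = w(a := j)"
    have "i = j" using fun_cong[OF *(3), of a] by simp
    moreover have "v = w"
    proof
      fix x show "v x = w x"
        using fun_cong[OF *(3), of x] *(1,2) insert.hyps(2) by (cases "x = a") (auto simp: PiE_iff extensional_def)
    qed
    ultimately show "i = j \<and> v = w" ..
  qed
  have "fps_nth (\<Prod>\<gamma>\<in>insert a C. indicator_fps (U \<gamma>)) k
     = (\<Sum>i=0..k. of_bool (i \<in> U a) * real (card (?W (k - i))))"
    using insert by (simp add: fps_mult_nth)
  also have "\<dots> = (\<Sum>i\<in>{i \<in> {0..k}. i \<in> U a}. real (card (?W (k - i))))"
    by (rule sum.mono_neutral_cong_right) auto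
  also have "\<dots> = real (card (SIGMA i:{i \<in> {0..k}. i \<in> U a}. ?W (k - i)))"
    using insert by (subst card_SigmaI) (auto intro: finite_PiE_sum_eq)
  also have "\<dots> = real (card {w \<in> PiE (insert a C) U. sum w (insert a C) = k})"
    unfolding eq by (simp only: card_image[OF inj])
  finally show ?case .
qed

text \<open>The number of descents acts as one more summand of the total \<open>k\<close>, so the
  Eulerian series multiplies the product of the weight series. Its factor
  \<open>(1 - fps_X) ^ r\<close> is then shared out, one \<open>1 - fps_X\<close> to each of the
  \<open>r\<close> cycles.\<close>

lemma card_ordered_weightings:
  assumes "finite C" "C \<noteq> {}"
  defines "r \<equiv> card C"
  shows "real (card {(p, w). p permutes {1..r} \<and> p r = 1 \<and> w \<in> PiE C U \<and> k = sum w C + des r p}) =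
    fps_nth (Abs_fps (\<lambda>j. real j ^ (r - 1)) * (\<Prod>\<gamma>\<in>C. (1 - fps_X) * indicator_fps (U \<gamma>))) k"
    and "finite {(p, w). p permutes {1..r} \<and> p r = 1 \<and> w \<in> PiE C U \<and> k = sum w C + des r p}"
proof -
  let ?P = "{p. p permutes {1..r} \<and> p r = 1}"
  \<comment> \<open>The guard excludes \<open>k < d\<close>, where the truncated difference
    \<open>k - d\<close> would be 0.\<close>
  let ?W = "\<lambda>d. if k < d then {} else {w \<in> PiE C U. sum w C = k - d}"
  have P: "finite ?P"
    by (rule finite_subset[OF _ finite_permutations[of "{1..r}"]]) auto
  have W: "finite (?W d)" for d using finite_PiE_sum_eq[OF assms(1)] by simp
  have eq: "{(p, w). p permutes {1..r} \<and> p r = 1 \<and> w \<in> PiE C U \<and> k = sum w C + des r p} =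
     (SIGMA p:?P. ?W (des r p))"
    by (auto split: if_splits)
  then show "finite {(p, w). p permutes {1..r} \<and> p r = 1 \<and> w \<in> PiE C U \<and> k = sum w C + des r p}"
    using P W by simp
  have r: "r > 0" using assms by (simp add: card_gt_0_iff)
  have "real (card (SIGMA p:?P. ?W (des r p))) = (\<Sum>p\<in>?P. real (card (?W (des r p))))"
    using P W by (subst card_SigmaI) auto
  also have "\<dots> = (\<Sum>p\<in>?P. fps_nth (fps_X ^ des r p * (\<Prod>\<gamma>\<in>C. indicator_fps (U \<gamma>))) k)"
    by (rule sum.cong) (auto simp: prod_indicator_fps_nth[OF assms(1)] fps_X_power_mult_nth)
  also have "\<dots> = fps_nth ((\<Sum>p\<in>?P. fps_X ^ des r p) * (\<Prod>\<gamma>\<in>C. indicator_fps (U \<gamma>))) k"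
    by (simp add: sum_distrib_right fps_sum_nth)
  also have "(\<Sum>p\<in>?P. fps_X ^ des r p) * (\<Prod>\<gamma>\<in>C. indicator_fps (U \<gamma>)) =
      Abs_fps (\<lambda>j. real j ^ (r - 1)) * (\<Prod>\<gamma>\<in>C. (1 - fps_X) * indicator_fps (U \<gamma>))"
    unfolding eulerian_series[OF r] by (simp add: prod.distrib r_def mult_ac)
  finally show "real (card {(p, w). p permutes {1..r} \<and> p r = 1 \<and> w \<in> PiE C U \<and> k = sum w C + des r p}) =
    fps_nth (Abs_fps (\<lambda>j. real j ^ (r - 1)) * (\<Prod>\<gamma>\<in>C. (1 - fps_X) * indicator_fps (U \<gamma>))) k"
    unfolding eq .
qed

text \<open>The four sets will all be brought into this form: a condition \<open>Q\<close> on the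
  permutation and a range \<open>U\<close> for the weight of each cycle. The count is then a sum
  over permutations of coefficients of products over cycles.\<close>

lemma card_cowps_type:
  assumes "n \<ge> 1"
  shows "real (card {(\<sigma>, p, w) \<in> cowps_type n r k. Q \<sigma> \<and> (\<forall>\<gamma>\<in>cyc n \<sigma>. w \<gamma> \<in> U \<sigma> \<gamma>)}) =
    (\<Sum>\<sigma> | \<sigma> permutes {1..n} \<and> card (cyc n \<sigma>) = r \<and> Q \<sigma>.
      fps_nth (Abs_fps (\<lambda>j. real j ^ (r - 1)) * (\<Prod>\<gamma>\<in>cyc n \<sigma>. (1 - fps_X) * indicator_fps (U \<sigma> \<gamma>))) k)"
    and "finite {(\<sigma>, p, w) \<in> cowps_type n r k. Q \<sigma> \<and> (\<forall>\<gamma>\<in>cyc n \<sigma>. w \<gamma> \<in> U \<sigma> \<gamma>)}"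
proof -
  let ?P = "{\<sigma>. \<sigma> permutes {1..n} \<and> card (cyc n \<sigma>) = r \<and> Q \<sigma>}"
  let ?W = "\<lambda>\<sigma>. {(p, w). p permutes {1..card (cyc n \<sigma>)} \<and> p (card (cyc n \<sigma>)) = 1 \<and>
     w \<in> PiE (cyc n \<sigma>) (U \<sigma>) \<and> k = sum w (cyc n \<sigma>) + des (card (cyc n \<sigma>)) p}"
  have P: "finite ?P"
    by (rule finite_subset[OF _ finite_permutations[of "{1..n}"]]) auto
  have C: "finite (cyc n \<sigma>)" "cyc n \<sigma> \<noteq> {}" for \<sigma>
    using assms by (auto simp: cyc_def)
  have eq: "{(\<sigma>, p, w) \<in> cowps_type n r k. Q \<sigma> \<and> (\<forall>\<gamma>\<in>cyc n \<sigma>. w \<gamma> \<in> U \<sigma> \<gamma>)} = Sigma ?P ?W"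
    by (auto simp: cowps_type_def cowps_def PiE_iff)
  show "finite {(\<sigma>, p, w) \<in> cowps_type n r k. Q \<sigma> \<and> (\<forall>\<gamma>\<in>cyc n \<sigma>. w \<gamma> \<in> U \<sigma> \<gamma>)}"
    unfolding eq using P card_ordered_weightings(2)[OF C] by (intro finite_SigmaI)
  have "real (card (Sigma ?P ?W)) = (\<Sum>\<sigma>\<in>?P. real (card (?W \<sigma>)))"
    using P card_ordered_weightings(2)[OF C] by (subst card_SigmaI) auto
  also have "\<dots> = (\<Sum>\<sigma>\<in>?P. fps_nth (Abs_fps (\<lambda>j. real j ^ (r - 1)) *
      (\<Prod>\<gamma>\<in>cyc n \<sigma>. (1 - fps_X) * indicator_fps (U \<sigma> \<gamma>))) k)"
  proof (rule sum.cong)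
    fix \<sigma> assume "\<sigma> \<in> ?P"
    then have r: "card (cyc n \<sigma>) = r" by simp
    show "real (card (?W \<sigma>)) = fps_nth (Abs_fps (\<lambda>j. real j ^ (r - 1)) *
        (\<Prod>\<gamma>\<in>cyc n \<sigma>. (1 - fps_X) * indicator_fps (U \<sigma> \<gamma>))) k"
      using card_ordered_weightings(1)[OF C, of \<sigma> "U \<sigma>" k] unfolding r .
  qed simp
  finally show "real (card {(\<sigma>, p, w) \<in> cowps_type n r k. Q \<sigma> \<and> (\<forall>\<gamma>\<in>cyc n \<sigma>. w \<gamma> \<in> U \<sigma> \<gamma>)}) =
    (\<Sum>\<sigma> | \<sigma> permutes {1..n} \<and> card (cyc n \<sigma>) = r \<and> Q \<sigma>.
      fps_nth (Abs_fps (\<lambda>j. real j ^ (r - 1)) * (\<Prod>\<gamma>\<in>cyc n \<sigma>. (1 - fps_X) * indicator_fps (U \<sigma> \<gamma>))) k)"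
    unfolding eq .
qed

section \<open>Products over cycles as signed sums over sets of cycles\<close>

lemma prod_one_minus_power:
  fixes x :: "'r :: comm_ring_1"
  assumes "finite I"
  shows "(\<Prod>i\<in>I. 1 - x ^ u i) = (\<Sum>J\<in>Pow I. (-1) ^ card J * x ^ sum u J)"
  using assms
proof (induction I)
  case (insert a I)
  have "finite J \<and> a \<notin> J" if "J \<in> Pow I" for J using that insert by (auto intro: finite_subset)
  then have *: "(-1) ^ card (insert a J) * x ^ sum u (insert a J) = - (x ^ u a * ((-1) ^ card J * x ^ sum u J))"
    if "J \<in> Pow I" for J using that by (simp add: power_add)
  show ?case
    unfolding sum_Pow_insert[OF insert.hyps] prod.insert[OF insert.hyps] insert.IH
    using * by (simp add: sum_negf sum_distrib_left[symmetric] left_diff_distrib)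
qed simp

text \<open>The least improper weight of a cycle and, for \<open>J \<subseteq> {1..n}\<close>, the
  largest value of the sum of the coordinates in \<open>J\<close> that the upper bounds of the
  polytope allow. It is not additive on disjoint sets: if one contains \<open>n - 1\<close> and the
  other \<open>n\<close>, the extra unit is counted only once in the union.\<close>

definition capacity :: "nat \<Rightarrow> (nat \<Rightarrow> nat) \<Rightarrow> nat set \<Rightarrow> nat" where
  "capacity n c J = (\<Sum>i\<in>J \<inter> {1..n-2}. c i) + of_bool (n - 1 \<in> J \<or> n \<in> J)"

lemma fps_nth_mult_X_power:
  "fps_nth (Abs_fps f * (fps_X :: real fps) ^ e) k = (if e \<le> k then f (k - e) else 0)"
  by (auto simp: fps_X_power_mult_right_nth)

text \<open>Cycles avoiding \<open>n - 1\<close> and \<open>n\<close> give a common factor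
  \<open>E\<close>, so only the cycles \<open>g1\<close> of \<open>n - 1\<close> and
  \<open>g2\<close> of \<open>n\<close> matter. If they differ, the first product expands with last
  exponent \<open>cs g1 + cs g2 + 2\<close>, while the union of \<open>g1\<close> and
  \<open>g2\<close> has capacity contribution \<open>cs g1 + cs g2 + 1\<close>. The second product
  equals \<open>(fps_X ^ (cs g1 + cs g2 + 1) - fps_X ^ (cs g1 + cs g2 + 2)) * E\<close> and makes
  exactly this correction. In the second identity the improper cycle of \<open>n - 1\<close> gives
  \<open>fps_X ^ d g1\<close>, which up to sign selects the sets \<open>T\<close> containing
  it.\<close>

lemma cycle_sum_products:
  fixes c :: "nat \<Rightarrow> nat" and \<sigma> :: "nat \<Rightarrow> nat"
  assumes n: "n \<ge> 2" and \<sigma>: "\<sigma> permutes {1..n}"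
  defines "C \<equiv> cyc n \<sigma>" and "d \<equiv> capacity n c"
  shows "(\<Prod>\<gamma>\<in>C. (1 - fps_X) * indicator_fps {..<d \<gamma>}) +
      (if orbit \<sigma> (n - 1) \<noteq> orbit \<sigma> n then
        \<Prod>\<gamma>\<in>C. (1 - fps_X) * indicator_fps
          (if n - 1 \<in> \<gamma> then {d \<gamma>..} else if n \<in> \<gamma> then {d \<gamma> - 1} else {..<d \<gamma>}) else 0) =
      (\<Sum>T\<in>Pow C. (-1) ^ card T * fps_X ^ d (\<Union>T))" (is ?thesis1)
    and "(\<Prod>\<gamma>\<in>C. (1 - fps_X) * indicator_fps
          (if n - 1 \<in> \<gamma> then {d \<gamma>..} else if n \<in> \<gamma> then {..<d \<gamma> - 1} else {..<d \<gamma>})) =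
      - (\<Sum>T\<in>Pow C. (-1) ^ card T * (of_bool (n - 1 \<in> \<Union>T) * fps_X ^ d (\<Union>T)))" (is ?thesis2)
proof -
  define cs where "cs J = (\<Sum>i\<in>J \<inter> {1..n-2}. c i)" for J
  define g1 g2 where "g1 = orbit \<sigma> (n - 1)" and "g2 = orbit \<sigma> n"
  define D where "D = C - {g1, g2}"
  have ps: "permutation \<sigma>" using \<sigma> by (auto simp: permutation_permutes)
  have C: "finite C" "g1 \<in> C" "g2 \<in> C" using n by (auto simp: C_def cyc_def g1_def g2_def)
  have in_orb: "\<gamma> = orbit \<sigma> i" if "\<gamma> \<in> C" "i \<in> \<gamma>" for \<gamma> i
    using that cyclic_on_orbit'[OF ps] orbit_cyclic_eq3 by (fastforce simp: C_def cyc_def)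
  have disj: "\<gamma> \<inter> \<delta> = {}" if "\<gamma> \<in> C" "\<delta> \<in> C" "\<gamma> \<noteq> \<delta>" for \<gamma> \<delta>
    using that in_orb by blast
  have fin: "finite \<gamma>" if "\<gamma> \<in> C" for \<gamma>
    using that finite_orbit[OF permutation_self_in_orbit[OF ps]] by (auto simp: C_def cyc_def)
  have g: "n - 1 \<in> g1" "n \<in> g2" using permutation_self_in_orbit[OF ps] by (auto simp: g1_def g2_def)
  have D: "finite D" "D \<subseteq> C" "g1 \<notin> D" "g2 \<notin> D" using C by (auto simp: D_def)
  have nD: "n - 1 \<notin> \<gamma>" "n \<notin> \<gamma>" if "\<gamma> \<in> D" for \<gamma>
    using that in_orb by (auto simp: D_def g1_def g2_def)
  have dD: "d \<gamma> = cs \<gamma>" if "\<gamma> \<in> D" for \<gamma> using nD[OF that] by (simp add: d_def capacity_def cs_def)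
  have dg: "d g1 = cs g1 + 1" "d g2 = cs g2 + 1" using g by (auto simp: d_def capacity_def cs_def)
  have csU: "cs (\<Union>T) = sum cs T" if "T \<subseteq> C" for T
  proof -
    have "cs (\<Union>T) = sum c (\<Union>\<gamma>\<in>T. \<gamma> \<inter> {1..n-2})" unfolding cs_def by (rule sum.cong) auto
    also have "\<dots> = sum cs T"
      unfolding cs_def using that C(1) disj by (intro sum.UNION_disjoint) (auto intro: finite_subset)
    finally show ?thesis .
  qed
  have T: "T \<subseteq> C" "finite T" "g1 \<notin> T" "g2 \<notin> T" "n - 1 \<notin> \<Union>T" "n \<notin> \<Union>T" if "T \<in> Pow D" for T
    using that D nD by (auto intro: finite_subset)
  define E where "E = (\<Sum>T\<in>Pow D. (-1) ^ card T * (fps_X :: real fps) ^ sum cs T)"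
  have prodD: "(\<Prod>\<gamma>\<in>D. (1 - fps_X) * indicator_fps (U \<gamma>)) = E" if "\<And>\<gamma>. \<gamma> \<in> D \<Longrightarrow> U \<gamma> = {..<d \<gamma>}" for U
  proof -
    have "(\<Prod>\<gamma>\<in>D. (1 - fps_X) * indicator_fps (U \<gamma>)) = (\<Prod>\<gamma>\<in>D. 1 - (fps_X :: real fps) ^ cs \<gamma>)"
      by (rule prod.cong) (simp_all only: that dD one_minus_X_indicator_lessThan)
    also have "\<dots> = E" unfolding E_def by (rule prod_one_minus_power[OF D(1)])
    finally show ?thesis .
  qed
  have d0: "d (\<Union>T) = sum cs T" if "T \<in> Pow D" for T
    using T[OF that] csU[of T] by (simp add: d_def capacity_def cs_def)
  have d1: "d (\<gamma> \<union> \<Union>T) = cs \<gamma> + sum cs T + 1" if "T \<in> Pow D" "\<gamma> = g1 \<or> \<gamma> = g2" for T \<gamma>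
  proof -
    have "cs (\<gamma> \<union> \<Union>T) = cs \<gamma> + sum cs T"
      using T[OF that(1)] csU[of "insert \<gamma> T"] C that(2) by auto
    then show ?thesis using g that(2) by (auto simp: d_def capacity_def cs_def)
  qed
  \<comment> \<open>The constant is 1 and not 2, since the capacity of a union counts the unit for
    \<open>n - 1\<close> and \<open>n\<close> once.\<close>
  have d2: "d (g1 \<union> (g2 \<union> \<Union>T)) = cs g1 + cs g2 + sum cs T + 1" if "T \<in> Pow D" "g1 \<noteq> g2" for T
  proof -
    have "cs (g1 \<union> (g2 \<union> \<Union>T)) = cs g1 + cs g2 + sum cs T"
      using T[OF that(1)] csU[of "insert g1 (insert g2 T)"] C that(2) by auto
    then show ?thesis using g that(2) by (auto simp: d_def capacity_def cs_def)
  qed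
  have c1: "card (insert \<gamma> T) = Suc (card T)" if "T \<in> Pow D" "\<gamma> = g1 \<or> \<gamma> = g2" for T \<gamma>
    using T[OF that(1)] that(2) by auto
  have c2: "card (insert g1 (insert g2 T)) = Suc (Suc (card T))" if "T \<in> Pow D" "g1 \<noteq> g2" for T
    using T[OF that(1)] that(2) by auto
  have "?thesis1 \<and> ?thesis2"
  proof (cases "g1 = g2")
    case True
    then have CD: "C = insert g1 D" using C by (auto simp: D_def)
    have e1: "(\<Sum>T\<in>Pow C. (-1) ^ card T * fps_X ^ d (\<Union>T)) = E - (fps_X :: real fps) ^ d g1 * E"
      unfolding CD sum_Pow_insert[OF D(1,3)] E_def
      by (simp add: d0 d1 c1 dg sum_negf sum_distrib_left power_add mult_ac)
    have e2: "(\<Sum>T\<in>Pow C. (-1) ^ card T * (of_bool (n - 1 \<in> \<Union>T) * fps_X ^ d (\<Union>T)))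
       = - ((fps_X :: real fps) ^ d g1 * E)"
    proof -
      show ?thesis
      unfolding CD sum_Pow_insert[OF D(1,3)] E_def
      using T(5) g by (simp add: d0 d1 c1 dg sum_negf sum_distrib_left power_add mult_ac del: Union_iff)
    qed
    have p1: "(\<Prod>\<gamma>\<in>C. (1 - fps_X) * indicator_fps {..<d \<gamma>}) = (1 - fps_X ^ d g1) * E"
      unfolding CD prod.insert[OF D(1,3)] one_minus_X_indicator_lessThan[of "d g1"]
      using prodD[of "\<lambda>\<gamma>. {..<d \<gamma>}"] by simp
    let ?U = "\<lambda>\<gamma>. if n - 1 \<in> \<gamma> then {d \<gamma>..} else if n \<in> \<gamma> then {..<d \<gamma> - 1} else {..<d \<gamma>}"
    have U: "?U g1 = {d g1..}" using g by simp
    have p2: "(\<Prod>\<gamma>\<in>C. (1 - fps_X) * indicator_fps (?U \<gamma>)) = fps_X ^ d g1 * E"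
      unfolding CD prod.insert[OF D(1,3)] U one_minus_X_indicator_atLeast[of "d g1"]
      using prodD[of ?U] nD by simp
    have o: "orbit \<sigma> (n - 1) = orbit \<sigma> n" using True by (simp add: g1_def g2_def)
    show ?thesis
      unfolding p1 p2 e1 e2 using o by (simp add: left_diff_distrib)
  next
    case False
    then have CD: "C = insert g1 (insert g2 D)" using C by (auto simp: D_def)
    have D': "finite (insert g2 D)" "g1 \<notin> insert g2 D" using D False by auto
    have ng: "n \<notin> g1" "n - 1 \<notin> g2" using in_orb C False g1_def g2_def by blast+
    have e1: "(\<Sum>T\<in>Pow C. (-1) ^ card T * fps_X ^ d (\<Union>T)) =
       E - (fps_X :: real fps) ^ d g1 * E - (fps_X :: real fps) ^ d g2 * E + fps_X ^ (cs g1 + cs g2 + 1) * E"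
      unfolding CD sum_Pow_insert[OF D'] sum_Pow_insert[OF D(1,4)] E_def
      by (simp add: False d0 d1 d2 c1 c2 dg sum_negf sum_distrib_left power_add mult_ac)
    have e2: "(\<Sum>T\<in>Pow C. (-1) ^ card T * (of_bool (n - 1 \<in> \<Union>T) * fps_X ^ d (\<Union>T)))
       = - ((fps_X :: real fps) ^ d g1 * E) + fps_X ^ (cs g1 + cs g2 + 1) * E"
    proof -
      show ?thesis
      unfolding CD sum_Pow_insert[OF D'] sum_Pow_insert[OF D(1,4)] E_def
      using T(5) g ng by (simp add: False d0 d1 d2 c1 c2 dg sum_negf sum_distrib_left power_add mult_ac del: Union_iff)
    qed
    have p1: "(\<Prod>\<gamma>\<in>C. (1 - fps_X) * indicator_fps {..<d \<gamma>}) = (1 - fps_X ^ d g1) * ((1 - fps_X ^ d g2) * E)"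
      unfolding CD prod.insert[OF D'] prod.insert[OF D(1,4)] one_minus_X_indicator_lessThan[of "d g1"] one_minus_X_indicator_lessThan[of "d g2"]
      using prodD[of "\<lambda>\<gamma>. {..<d \<gamma>}"] by simp
    let ?U = "\<lambda>\<gamma>. if n - 1 \<in> \<gamma> then {d \<gamma>..} else if n \<in> \<gamma> then {..<d \<gamma> - 1} else {..<d \<gamma>}"
    let ?V = "\<lambda>\<gamma>. if n - 1 \<in> \<gamma> then {d \<gamma>..} else if n \<in> \<gamma> then {d \<gamma> - 1} else {..<d \<gamma>}"
    have U: "?U g1 = {d g1..}" "?U g2 = {..<cs g2}" "?V g1 = {d g1..}" "?V g2 = {cs g2}" using g ng dg by simp_all
    have p2: "(\<Prod>\<gamma>\<in>C. (1 - fps_X) * indicator_fps (?U \<gamma>)) = fps_X ^ d g1 * ((1 - fps_X ^ cs g2) * E)"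
      unfolding CD prod.insert[OF D'] prod.insert[OF D(1,4)] U one_minus_X_indicator_atLeast[of "d g1"] one_minus_X_indicator_lessThan[of "cs g2"]
      using prodD[of ?U] nD by simp
    have p3: "(\<Prod>\<gamma>\<in>C. (1 - fps_X) * indicator_fps (?V \<gamma>)) = fps_X ^ d g1 * (((1 - fps_X) * fps_X ^ cs g2) * E)"
      unfolding CD prod.insert[OF D'] prod.insert[OF D(1,4)] U one_minus_X_indicator_atLeast[of "d g1"] indicator_fps_singleton
      using prodD[of ?V] nD by simp
    have o: "orbit \<sigma> (n - 1) \<noteq> orbit \<sigma> n" using False by (simp add: g1_def g2_def)
    show ?thesis
      unfolding p1 p2 p3 e1 e2 using o by (simp add: dg algebra_simps power_add)
  qed
  then show ?thesis1 ?thesis2 by blast+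
qed

text \<open>With the polynomial variable as \<open>y\<close>, the exponent records the number of
  cycles, so taking the coefficient at \<open>r\<close> restricts the sum to permutations with
  \<open>r\<close> cycles.\<close>

lemma sum_signed_cycle_sets_coeff:
  fixes g :: "nat set \<Rightarrow> real"
  shows "(\<Sum>\<sigma> | \<sigma> permutes {1..n} \<and> card (cyc n \<sigma>) = r. \<Sum>T\<in>Pow (cyc n \<sigma>). (-1) ^ card T * g (\<Union>T)) =
    (\<Sum>J\<in>Pow {1..n}. coeff (pochhammer (- [:0, 1:]) (card J) * pochhammer [:0, 1:] (n - card J)) r * g J)"
proof -
  have y: "([:0, 1:] :: real poly) ^ j = monom 1 j" for j by (simp add: monom_altdef)
  have s: "(-1 :: real poly) ^ j = [:(-1) ^ j:]" for j by (induction j) (auto simp: one_pCons)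
  have "coeff (\<Sum>q | q permutes {1..n}. \<Sum>T\<in>Pow (orbit q ` {1..n}). (-1) ^ card T * [:0, 1:] ^ card (orbit q ` {1..n}) * [:g (\<Union>T):]) r
    = (\<Sum>q | q permutes {1..n}. if card (cyc n q) = r then \<Sum>T\<in>Pow (cyc n q). (-1) ^ card T * g (\<Union>T) else 0)"
    unfolding coeff_sum y s cyc_def by (intro sum.cong) (auto simp: mult_ac)
  also have "\<dots> = (\<Sum>\<sigma> | \<sigma> permutes {1..n} \<and> card (cyc n \<sigma>) = r. \<Sum>T\<in>Pow (cyc n \<sigma>). (-1) ^ card T * g (\<Union>T))"
    by (subst sum.inter_filter[symmetric]) (auto simp: finite_permutations)
  also have "coeff (\<Sum>q | q permutes {1..n}. \<Sum>T\<in>Pow (orbit q ` {1..n}). (-1) ^ card T * [:0, 1:] ^ card (orbit q ` {1..n}) * [:g (\<Union>T):]) r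
    = (\<Sum>J\<in>Pow {1..n}. coeff (pochhammer (- [:0, 1:]) (card J) * pochhammer [:0, 1:] (n - card J)) r * g J)"
    unfolding sum_signed_cycle_sets[of "{1..n}" "[:0, 1:]" "\<lambda>J. [:g J:]", OF finite_atLeastAtMost] coeff_sum
  proof (intro sum.cong)
    fix J assume "J \<in> Pow {1..n}"
    then have "card ({1..n} - J) = n - card J" by (subst card_Diff_subset) (auto intro: finite_subset)
    then show "coeff (pochhammer (- [:0, 1:]) (card J) * pochhammer [:0, 1:] (card ({1..n} - J)) * [:g J:]) r =
      coeff (pochhammer (- [:0, 1:]) (card J) * pochhammer [:0, 1:] (n - card J)) r * g J"
      by (simp add: mult.commute)
  qed simp
  finally show ?thesis by simp
qed


section \<open>The Ehrhart polynomial\<close>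

lemma in_dilate_slice_iff:
  assumes "t > 0" "n \<ge> 2"
  shows "y \<in> dilate t (slice n c k) \<longleftrightarrow> y \<in> real_space n \<and> (\<forall>i\<in>{1..n}. 0 \<le> y i) \<and>
    (\<Sum>i=1..n. y i) = real t * real k \<and> (\<forall>i\<in>{1..n-2}. y i \<le> real t * real (c i)) \<and> y (n - 1) + y n \<le> real t"
    (is "_ \<longleftrightarrow> ?R y")
proof
  assume "y \<in> dilate t (slice n c k)"
  then obtain x where x: "x \<in> slice n c k" "y = (\<lambda>i. real t * x i)" by (auto simp: dilate_def)
  have "(\<Sum>i=1..n. y i) = real t * (\<Sum>i=1..n. x i)" unfolding x(2) by (rule sum_distrib_left[symmetric])
  moreover have "y (n - 1) + y n = real t * (x (n - 1) + x n)" unfolding x(2) by (simp add: distrib_left)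
  moreover have "\<dots> \<le> real t * 1" using x(1) by (intro mult_left_mono) (auto simp: slice_def)
  ultimately show "?R y" using x assms by (auto simp: slice_def real_space_def)
next
  assume y: "?R y"
  define x where "x = (\<lambda>i. y i / real t)"
  have "(\<Sum>i=1..n. x i) = (\<Sum>i=1..n. y i) / real t" unfolding x_def by (rule sum_divide_distrib[symmetric])
  moreover have "x (n - 1) + x n = (y (n - 1) + y n) / real t" unfolding x_def by (simp add: add_divide_distrib)
  moreover have "\<dots> \<le> 1" using y assms by simp
  ultimately have "x \<in> slice n c k"
    using y assms by (auto simp: slice_def real_space_def x_def divide_le_eq mult.commute)
  moreover have "y = (\<lambda>i. real t * x i)" using assms by (simp add: x_def)
  ultimately show "y \<in> dilate t (slice n c k)" by (auto simp: dilate_def)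
qed

lemma card_lattice_points:
  assumes "t > 0" "n \<ge> 2"
  shows "card (dilate t (slice n c k) \<inter> int_lattice n) = card {x \<in> {1..n} \<rightarrow>\<^sub>E UNIV.
    (\<forall>i\<in>{1..n-2}. x i \<le> t * c i) \<and> x (n - 1) + x n \<le> t \<and> sum x {1..n} = t * k}" (is "card ?L = card ?N")
proof -
  let ?f = "\<lambda>x i. if i \<in> {1..n} then real (x i) else 0 :: real"
  have n: "n - 1 \<in> {1..n}" "n \<in> {1..n}" using assms by auto
  have iff: "?f x \<in> ?L \<longleftrightarrow> (\<forall>i\<in>{1..n-2}. x i \<le> t * c i) \<and> x (n - 1) + x n \<le> t \<and> sum x {1..n} = t * k" for x
  proof -
    have "(\<Sum>i=1..n. ?f x i) = real (sum x {1..n})" by simp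
    then have sum: "(\<Sum>i=1..n. ?f x i) = real t * real k \<longleftrightarrow> sum x {1..n} = t * k"
      by (simp only: of_nat_mult[symmetric] of_nat_eq_iff)
    have "?f x i \<le> real t * real (c i) \<longleftrightarrow> x i \<le> t * c i" if "i \<in> {1..n-2}" for i
    proof -
      have "i \<in> {1..n}" using that by auto
      then show ?thesis by (simp only: if_True of_nat_mult[symmetric] of_nat_le_iff)
    qed
    then have box: "(\<forall>i\<in>{1..n-2}. ?f x i \<le> real t * real (c i)) \<longleftrightarrow> (\<forall>i\<in>{1..n-2}. x i \<le> t * c i)"
      by (rule ball_cong[OF refl])
    have last: "?f x (n - 1) + ?f x n \<le> real t \<longleftrightarrow> x (n - 1) + x n \<le> t"
      using n by (simp only: if_True of_nat_add[symmetric] of_nat_le_iff)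
    have "?f x \<in> int_lattice n" "?f x \<in> real_space n" "\<forall>i\<in>{1..n}. 0 \<le> ?f x i"
      by (simp_all add: int_lattice_def real_space_def)
    then show ?thesis
      unfolding Int_iff in_dilate_slice_iff[OF assms] sum box last by blast
  qed
  have "bij_betw ?f ?N ?L"
  proof (rule bij_betw_imageI)
    show "inj_on ?f ?N"
    proof (rule inj_onI)
      fix x y assume xy: "x \<in> ?N" "y \<in> ?N" "?f x = ?f y"
      show "x = y"
      proof
        fix i show "x i = y i"
        proof (cases "i \<in> {1..n}")
          case True
          then show ?thesis using fun_cong[OF xy(3), of i] by simp
        next
          case False
          then show ?thesis using xy(1,2) by (auto simp: PiE_iff extensional_def)
        qed
      qed
    qed
    show "?f ` ?N = ?L"
    proof (intro equalityI subsetI)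
      fix y assume "y \<in> ?f ` ?N"
      then show "y \<in> ?L" using iff by blast
    next
      fix y assume y: "y \<in> ?L"
      define x where "x = restrict (\<lambda>i. nat \<lfloor>y i\<rfloor>) {1..n}"
      have "y i = ?f x i" for i
      proof (cases "i \<in> {1..n}")
        case True
        then have "y i \<in> \<int>" "0 \<le> y i"
          using y unfolding Int_iff in_dilate_slice_iff[OF assms] int_lattice_def by auto
        then show ?thesis using True by (auto simp: x_def elim!: Ints_cases)
      next
        case False
        then show ?thesis using y unfolding Int_iff in_dilate_slice_iff[OF assms] real_space_def by auto
      qed
      then have "y = ?f x" ..
      moreover have "x \<in> {1..n} \<rightarrow>\<^sub>E UNIV" by (simp add: x_def)
      ultimately show "y \<in> ?f ` ?N" using iff y by blast
    qed
  qed
  then show ?thesis by (rule bij_betw_same_card[symmetric])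
qed

lemma insert_last_two: "n \<ge> 2 \<Longrightarrow> {1..n} = insert (n - 1) (insert n {1..n-2})" for n :: nat
  by auto

lemma lattice_points_series:
  assumes "t > 0" "n \<ge> 2"
  shows "real (card (dilate t (slice n c k) \<inter> int_lattice n)) =
    fps_nth (inverse ((1 - fps_X) ^ n) * (\<Sum>J\<in>Pow {1..n}. (-1) ^ card J * fps_const (1 + real t * of_bool (n - 1 \<in> J)) *
      fps_X ^ (t * capacity n c J + card J))) (t * k)"
proof -
  let ?X = "fps_X :: real fps"
  \<comment> \<open>Fixing the last coordinate to be \<open>a\<close> decouples the constraint on
    the last two coordinates: all coordinates then range independently over the sets
    \<open>V a i\<close>.\<close>
  define V where "V a i = (if i = n then {a} else if i = n - 1 then {..<t - a + 1} else {..<t * c i + 1})" for a i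
  have nn: "n - 1 \<in> {1..n}" "n \<in> {1..n}" using assms by auto
  have n: "n - 1 \<noteq> n" "n - 1 \<notin> insert n {1..n-2}" "n \<notin> {1..n-2}" using assms by auto
  have fin: "finite {x \<in> PiE {1..n} (V a). sum x {1..n} = t * k}" for a by (rule finite_PiE_sum_eq) simp
  have "{x \<in> {1..n} \<rightarrow>\<^sub>E UNIV. (\<forall>i\<in>{1..n-2}. x i \<le> t * c i) \<and> x (n - 1) + x n \<le> t \<and> sum x {1..n} = t * k}
     = (\<Union>a\<in>{..t}. {x \<in> PiE {1..n} (V a). sum x {1..n} = t * k})"
    (is "?N = ?M")
  proof -
    have "(\<exists>a\<le>t. x \<in> PiE {1..n} (V a)) \<longleftrightarrow> x \<in> {1..n} \<rightarrow>\<^sub>E UNIV \<and> (\<forall>i\<in>{1..n-2}. x i \<le> t * c i) \<and> x (n - 1) + x n \<le> t" for x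
    proof
      assume "\<exists>a\<le>t. x \<in> PiE {1..n} (V a)"
      then obtain a where a: "a \<le> t" "x \<in> PiE {1..n} (V a)" by blast
      have xV: "x i \<in> V a i" if "i \<in> {1..n}" for i using a(2) that by (rule PiE_mem)
      have "x n = a" using xV[OF nn(2)] by (simp add: V_def)
      moreover have "x (n - 1) \<le> t - a" using xV[OF nn(1)] n(1) by (simp add: V_def)
      moreover have "x i \<le> t * c i" if "i \<in> {1..n-2}" for i
      proof -
        have "i \<in> {1..n}" "i \<noteq> n" "i \<noteq> n - 1" using that by auto
        then show ?thesis using xV[of i] by (simp add: V_def)
      qed
      ultimately show "x \<in> {1..n} \<rightarrow>\<^sub>E UNIV \<and> (\<forall>i\<in>{1..n-2}. x i \<le> t * c i) \<and> x (n - 1) + x n \<le> t"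
        using a by (auto simp: PiE_iff)
    next
      assume *: "x \<in> {1..n} \<rightarrow>\<^sub>E UNIV \<and> (\<forall>i\<in>{1..n-2}. x i \<le> t * c i) \<and> x (n - 1) + x n \<le> t"
      have "x i \<in> V (x n) i" if i: "i \<in> {1..n}" for i
      proof -
        consider "i = n" | "i = n - 1" | "i \<in> {1..n-2}" using i unfolding insert_last_two[OF assms(2)] by blast
        then show ?thesis by cases (use * n in \<open>auto simp: V_def less_Suc_eq_le\<close>)
      qed
      then show "\<exists>a\<le>t. x \<in> PiE {1..n} (V a)" using * by (intro exI[of _ "x n"]) (auto simp: PiE_iff)
    qed
    then show ?thesis by (intro set_eqI) (simp only: UN_iff mem_Collect_eq atMost_iff Bex_def, blast)
  qed
  then have "real (card (dilate t (slice n c k) \<inter> int_lattice n)) =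
     real (card (\<Union>a\<in>{..t}. {x \<in> PiE {1..n} (V a). sum x {1..n} = t * k}))"
    unfolding card_lattice_points[OF assms] by simp
  also have "\<dots> = (\<Sum>a\<le>t. real (card {x \<in> PiE {1..n} (V a). sum x {1..n} = t * k}))"
  proof (subst card_UN_disjoint)
    have "x n = a" if "x \<in> PiE {1..n} (V a)" for x a
      using PiE_mem[OF that, of n] assms by (simp add: V_def)
    then show "\<forall>a\<in>{..t}. \<forall>b\<in>{..t}. a \<noteq> b \<longrightarrow> {x \<in> PiE {1..n} (V a). sum x {1..n} = t * k} \<inter>
       {x \<in> PiE {1..n} (V b). sum x {1..n} = t * k} = {}" by blast
  qed (use fin in auto)
  also have "\<dots> = fps_nth (\<Sum>a\<le>t. \<Prod>i\<in>{1..n}. indicator_fps (V a i)) (t * k)"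
    unfolding fps_sum_nth by (simp only: prod_indicator_fps_nth[OF finite_atLeastAtMost])
  also have "(\<Sum>a\<le>t. \<Prod>i\<in>{1..n}. indicator_fps (V a i)) = inverse ((1 - ?X) ^ n) *
      (\<Sum>a\<le>t. \<Prod>i\<in>{1..n}. (1 - ?X) * indicator_fps (V a i))"
  proof -
    have "inverse ((1 - ?X) ^ n) * (1 - ?X) ^ n = 1" by (rule inverse_mult_eq_1) simp
    then show ?thesis
      by (simp add: prod.distrib sum_distrib_left[symmetric] mult.assoc[symmetric])
  qed
  also have "(\<Sum>a\<le>t. \<Prod>i\<in>{1..n}. (1 - ?X) * indicator_fps (V a i)) =
      (\<Sum>J\<in>Pow {1..n}. (-1) ^ card J * fps_const (1 + real t * of_bool (n - 1 \<in> J)) * ?X ^ (t * capacity n c J + card J))"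
  proof -
    define E where "E = (\<Sum>J\<in>Pow {1..n-2}. (-1) ^ card J * ?X ^ (t * sum c J + card J))"
    have E: "(\<Prod>i\<in>{1..n-2}. 1 - ?X ^ (t * c i + 1)) = E"
      unfolding prod_one_minus_power[OF finite_atLeastAtMost] E_def
      by (simp only: sum.distrib sum_distrib_left[symmetric] card_eq_sum)
    have "(\<Sum>a\<le>t. \<Prod>i\<in>{1..n}. (1 - ?X) * indicator_fps (V a i)) =
       (\<Sum>a\<le>t. (1 - ?X ^ (t - a + 1)) * (((1 - ?X) * ?X ^ a) * E))"
    proof (rule sum.cong)
      fix a assume "a \<in> {..t}"
      have Vn: "V a (n - 1) = {..<t - a + 1}" "V a n = {a}" using n by (auto simp: V_def)
      have "(\<Prod>i\<in>{1..n-2}. (1 - ?X) * indicator_fps (V a i)) = (\<Prod>i\<in>{1..n-2}. 1 - ?X ^ (t * c i + 1))"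
      proof (rule prod.cong)
        fix i assume "i \<in> {1..n-2}"
        then have "V a i = {..<t * c i + 1}" by (auto simp: V_def)
        then show "(1 - ?X) * indicator_fps (V a i) = 1 - ?X ^ (t * c i + 1)"
          by (simp only: one_minus_X_indicator_lessThan)
      qed simp
      moreover have "finite (insert n {1..n-2})" by simp
      ultimately show "(\<Prod>i\<in>{1..n}. (1 - ?X) * indicator_fps (V a i)) = (1 - ?X ^ (t - a + 1)) * (((1 - ?X) * ?X ^ a) * E)"
        unfolding insert_last_two[OF assms(2)]
        by (simp only: prod.insert[OF _ n(2)] prod.insert[OF finite_atLeastAtMost n(3)] Vn indicator_fps_singleton one_minus_X_indicator_lessThan E)
    qed simp
    \<comment> \<open>The powers \<open>t - a + 1\<close> and \<open>a\<close> add up to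
      \<open>t + 1\<close>, so all \<open>t + 1\<close> values of \<open>a\<close> subtract the same
      term. This is the source of the coefficients that are linear in \<open>t\<close>.\<close>
    also have "\<dots> = (\<Sum>a\<le>t. (1 - ?X) * ?X ^ a - (1 - ?X) * ?X ^ (t + 1)) * E"
      unfolding sum_distrib_right
    proof (rule sum.cong)
      fix a assume "a \<in> {..t}"
      then have "?X ^ (t + 1) = ?X ^ (t - a + 1) * ?X ^ a" by (simp add: power_add[symmetric])
      then show "(1 - ?X ^ (t - a + 1)) * (((1 - ?X) * ?X ^ a) * E) = ((1 - ?X) * ?X ^ a - (1 - ?X) * ?X ^ (t + 1)) * E"
        by (simp only:) (simp add: algebra_simps)
    qed simp
    also have "(\<Sum>a\<le>t. (1 - ?X) * ?X ^ a - (1 - ?X) * ?X ^ (t + 1)) =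
        1 - fps_const (2 + real t) * ?X ^ (t + 1) + fps_const (1 + real t) * ?X ^ (t + 2)"
    proof -
      have geometric: "(\<Sum>a\<le>t. (1 - ?X) * ?X ^ a) = 1 - ?X ^ (t + 1)"
        using sum_gp_basic[of ?X t] by (simp only: sum_distrib_left Suc_eq_plus1)
      have const: "(\<Sum>a\<le>t. (1 - ?X) * ?X ^ (t + 1)) = (1 + of_nat t) * ((1 - ?X) * ?X ^ (t + 1))"
        by simp
      have f: "fps_const (2 + real t) = 2 + of_nat t" "fps_const (1 + real t) = 1 + of_nat t"
        by (simp_all add: fps_of_nat[symmetric] numeral_fps_const fps_const_add[symmetric] del: fps_const_add)
      show ?thesis
        unfolding f sum_subtractf geometric const by (simp add: algebra_simps)
    qed
    also have "(1 - fps_const (2 + real t) * ?X ^ (t + 1) + fps_const (1 + real t) * ?X ^ (t + 2)) * E =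
      (\<Sum>J\<in>Pow {1..n}. (-1) ^ card J * fps_const (1 + real t * of_bool (n - 1 \<in> J)) * ?X ^ (t * capacity n c J + card J))"
    proof -
      let ?F = "\<lambda>J. (-1) ^ card J * fps_const (1 + real t * of_bool (n - 1 \<in> J)) * ?X ^ (t * capacity n c J + card J)"
      have J: "J \<inter> {1..n-2} = J" "finite J" "n \<notin> J" "n - 1 \<notin> J" if "J \<in> Pow {1..n-2}" for J
        using that n by (auto intro: finite_subset)
      define e where "e J = (-1) ^ card J * ?X ^ (t * sum c J + card J)" for J
      have sc: "(\<Sum>i\<in>insert m J \<inter> {1..n-2}. c i) = (\<Sum>i\<in>J \<inter> {1..n-2}. c i)" if "m = n \<or> m = n - 1" for J m
        by (rule sum.cong) (use that assms n in auto)
      have F: "?F J = e J" "?F (insert n J) = - (?X ^ (t + 1) * e J)"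
        "?F (insert (n - 1) J) = - (fps_const (1 + real t) * ?X ^ (t + 1) * e J)"
        "?F (insert (n - 1) (insert n J)) = fps_const (1 + real t) * ?X ^ (t + 2) * e J"
        if "J \<in> Pow {1..n-2}" for J
        using J[OF that] n
        by (simp_all add: e_def capacity_def sc card_insert_if power_add distrib_left mult_ac del: fps_const_add)
      have "(\<Sum>J\<in>Pow {1..n}. ?F J) =
        (\<Sum>J\<in>Pow {1..n-2}. ?F J) + (\<Sum>J\<in>Pow {1..n-2}. ?F (insert n J)) +
        ((\<Sum>J\<in>Pow {1..n-2}. ?F (insert (n - 1) J)) + (\<Sum>J\<in>Pow {1..n-2}. ?F (insert (n - 1) (insert n J))))"
        unfolding insert_last_two[OF assms(2)] sum_Pow_insert[OF finite.insertI[OF finite_atLeastAtMost] n(2)]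
          sum_Pow_insert[OF finite_atLeastAtMost n(3)] ..
      also have "\<dots> = (\<Sum>J\<in>Pow {1..n-2}. e J) + (\<Sum>J\<in>Pow {1..n-2}. - (?X ^ (t + 1) * e J)) +
        ((\<Sum>J\<in>Pow {1..n-2}. - (fps_const (1 + real t) * ?X ^ (t + 1) * e J)) +
         (\<Sum>J\<in>Pow {1..n-2}. fps_const (1 + real t) * ?X ^ (t + 2) * e J))"
        by (intro arg_cong2[of _ _ _ _ plus] sum.cong F refl)
      also have "\<dots> = E - ?X ^ (t + 1) * E - (fps_const (1 + real t) * ?X ^ (t + 1) * E)
           + fps_const (1 + real t) * ?X ^ (t + 2) * E"
        unfolding E_def e_def[symmetric] sum_negf sum_distrib_left[symmetric] by simp
      finally have "(\<Sum>J\<in>Pow {1..n}. ?F J) = E - ?X ^ (t + 1) * E - (fps_const (1 + real t) * ?X ^ (t + 1) * E)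
           + fps_const (1 + real t) * ?X ^ (t + 2) * E" .
      \<comment> \<open>The coefficient \<open>t + 2\<close> of \<open>fps_X ^ (t + 1)\<close> is
        split into 1 for sets containing only \<open>n\<close> of the last two elements and
        \<open>1 + t\<close> for those containing only \<open>n - 1\<close>. This choice attaches
        the factor \<open>1 + t\<close> to \<open>n - 1\<close>.\<close>
      moreover have "fps_const (2 + real t) = 1 + fps_const (1 + real t)"
        by (simp add: fps_const_1_eq_1[symmetric] del: fps_const_1_eq_1)
      ultimately show ?thesis by (simp add: algebra_simps del: fps_const_add)
    qed
    finally show ?thesis .
  qed
  finally show ?thesis .
qed

text \<open>At \<open>x\<close> this is \<open>(-1) ^ i\<close> times \<open>(n - 1)!\<close> times
  the binomial coefficient of \<open>x + n - 1 - i\<close> over \<open>n - 1\<close>, the form in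
  which the two sides of the theorem meet.\<close>

definition cycle_poly :: "nat \<Rightarrow> nat \<Rightarrow> real poly" where
  "cycle_poly n i = (-1) ^ i * pochhammer [:1 - real i, 1:] (n - 1)"

text \<open>Up to sign, the first symbol is the falling product from \<open>y\<close> to
  \<open>y - i + 1\<close>, and the second rises from \<open>y\<close>. With one factor
  \<open>y\<close> set aside, the rest is a run of \<open>n - 1\<close> consecutive factors. That
  extra \<open>y\<close> causes the shift between \<open>m + 1\<close> cycles and the coefficient of
  degree \<open>m\<close>.\<close>

lemma pochhammer_split_cycle_poly:
  assumes "n \<ge> 1" "i \<le> n"
  shows "pochhammer (- [:0, 1:]) i * pochhammer [:0, 1:] (n - i) = [:0, 1:] * cycle_poly n i"
proof -
  let ?y = "[:0, 1:] :: real poly"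
  have y: "[:1 - real i, 1:] = ?y - of_nat i + 1" by (simp add: of_nat_poly one_pCons)
  show ?thesis
  proof (cases i)
    case 0
    then show ?thesis
      using assms pochhammer_rec[of ?y "n - 1"] unfolding cycle_poly_def y by simp
  next
    case (Suc j)
    let ?z = "?y - of_nat i + 1"
    have z: "?z + of_nat j = ?y" using Suc by simp
    have n: "n - 1 = j + (n - i)" using assms Suc by simp
    have "pochhammer (- ?y) i = (-1) ^ i * (pochhammer ?z j * ?y)"
      unfolding pochhammer_minus using Suc z by (simp add: pochhammer_Suc)
    moreover have "pochhammer ?z (n - 1) = pochhammer ?z j * pochhammer ?y (n - i)"
      unfolding n pochhammer_product' z ..
    ultimately show ?thesis unfolding cycle_poly_def y by (simp only: mult_ac)
  qed
qed

lemma coeff_pochhammer_split: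
  assumes "n \<ge> 1" "i \<le> n"
  shows "coeff (pochhammer (- [:0, 1:]) i * pochhammer [:0, 1:] (n - i)) (Suc r) = coeff (cycle_poly n i) r"
  unfolding pochhammer_split_cycle_poly[OF assms] by simp

lemma poly_cycle_poly: "poly (cycle_poly n i) x = (-1) ^ i * pochhammer (x + 1 - real i) (n - 1)"
proof -
  have "poly (pochhammer [:1 - real i, 1:] m) x = pochhammer (x + 1 - real i) m" for m
    by (induction m) (simp_all add: pochhammer_Suc algebra_simps)
  moreover have "poly ((-1) ^ i) x = (-1 :: real) ^ i" by (simp add: poly_power)
  ultimately show ?thesis by (simp add: cycle_poly_def)
qed

text \<open>At 0 the factors run from \<open>1 - i\<close> to \<open>n - 1 - i\<close>, and 0 is
  among them unless \<open>i = 0\<close> or \<open>i = n\<close>.\<close>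

lemma poly_cycle_poly_0:
  assumes "n \<ge> 1" "i \<le> n"
  shows "poly (cycle_poly n i) 0 = (if i = 0 then fact (n - 1) else if i = n then - fact (n - 1) else 0)"
proof (cases "0 < i \<and> i < n")
  case True
  then have "0 + 1 - real i = - real (i - 1)" "i - 1 < n - 1" by (auto simp: of_nat_diff)
  then have "pochhammer (0 + 1 - real i) (n - 1) = 0"
    by (simp only: pochhammer_of_nat_eq_0_lemma)
  then show ?thesis using True by (simp only: poly_cycle_poly) simp
next
  case False
  then consider "i = 0" | "i = n" using assms by linarith
  then show ?thesis
  proof cases
    case 1
    then show ?thesis by (simp add: poly_cycle_poly pochhammer_fact)
  next
    case 2
    have "0 + 1 - real n = - real (n - 1)" using assms by (simp add: of_nat_diff)
    then have "pochhammer (0 + 1 - real n) (n - 1) = (-1) ^ (n - 1) * fact (n - 1)"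
      by (simp only: pochhammer_same)
    moreover have "(-1 :: real) ^ n * ((-1) ^ (n - 1) * x) = - x" for x
      using assms by (cases n) (simp_all add: power_mult_distrib[symmetric] mult.assoc[symmetric])
    ultimately show ?thesis using 2 assms by (simp only: poly_cycle_poly) simp
  qed
qed

lemma capacity_empty [simp]: "capacity n c {} = 0"
  by (simp add: capacity_def)

text \<open>The truncation of the binomial coefficient happens at zeros of the polynomial.  The inequality
  \<open>capacity n c J < k\<close> must be strict, since \<open>cycle_poly n n\<close> does not vanish at \<open>0\<close>.\<close>

lemma ehrhart_term:
  assumes "n \<ge> 1" "t > 0" "k > 0" "J \<subseteq> {1..n}"
  shows "fact (n - 1) * ((-1) ^ card J *
      (if t * capacity n c J + card J \<le> t * k
       then real ((n + (t * k - (t * capacity n c J + card J)) - 1) choose (t * k - (t * capacity n c J + card J))) else 0)) =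
    (if capacity n c J < k then poly (cycle_poly n (card J)) (real t * (real k - real (capacity n c J))) else 0)"
proof -
  let ?e = "capacity n c J" and ?i = "card J"
  have finJ: "finite J" using assms(4) finite_subset by blast
  have i: "?i \<le> n" using card_mono[OF _ assms(4)] by simp
  show ?thesis
  proof (cases "?e < k")
    case e: True
    then have x: "real t * (real k - real ?e) = real (t * (k - ?e))" by (simp add: of_nat_diff)
    have tk: "t * (k - ?e) = t * k - t * ?e" by (rule diff_mult_distrib2)
    have le: "t * ?e \<le> t * k" using e by simp
    show ?thesis
    proof (cases "t * ?e + ?i \<le> t * k")
      case True
      define N where "N = t * k - (t * ?e + ?i)"
      have "(n + N - 1) choose N = (n + N - 1) choose (n - 1)"
        using assms(1) by (subst binomial_symmetric) auto
      also have "real \<dots> = pochhammer (real N + 1) (n - 1) / fact (n - 1)"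
        unfolding binomial_gbinomial gbinomial_pochhammer' using assms(1) by (simp add: of_nat_diff)
      finally have "fact (n - 1) * real ((n + N - 1) choose N) = pochhammer (real N + 1) (n - 1)" by simp
      also have "real N + 1 = real t * (real k - real ?e) + 1 - real ?i"
        unfolding x tk N_def of_nat_diff[OF True] of_nat_diff[OF le] by simp
      finally show ?thesis
        using True e unfolding poly_cycle_poly N_def by (simp only: if_True mult.left_commute[of "fact (n - 1)"])
    next
      case False
      \<comment> \<open>As \<open>0 < q < card J\<close>, one of the factors from
        \<open>q + 1 - card J\<close> to \<open>q + n - 1 - card J\<close> is 0. Positivity of
        \<open>q\<close> matters when \<open>card J = n\<close>.\<close>
      define q where "q = t * (k - ?e)"
      have "q > 0" using e assms(2) by (simp add: q_def)
      moreover have "q < ?i" unfolding q_def tk using False le by linarith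
      ultimately have "real q + 1 - real ?i = - real (?i - 1 - q)" "?i - 1 - q < n - 1"
        using i by auto
      then have "pochhammer (real q + 1 - real ?i) (n - 1) = 0"
        by (simp only: pochhammer_of_nat_eq_0_lemma)
      then show ?thesis using False e unfolding poly_cycle_poly x q_def by simp
    qed
  next
    case False
    have "\<not> t * ?e + ?i \<le> t * k"
    proof
      assume "t * ?e + ?i \<le> t * k"
      moreover have "t * k \<le> t * ?e" using False by simp
      ultimately have "?i = 0" by linarith
      then have "J = {}" using finJ by simp
      then show False using False assms(3) by simp
    qed
    then show ?thesis using False by simp
  qed
qed

text \<open>The linear factor stands for \<open>1 + t * of_bool (n - 1 \<in> J)\<close>. The
  condition \<open>capacity n c J < k\<close> does not involve the dilation factor \<open>t\<close>,
  which is why the count is a polynomial in \<open>t\<close>.\<close>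

definition ehrhart_poly :: "nat \<Rightarrow> (nat \<Rightarrow> nat) \<Rightarrow> nat \<Rightarrow> real poly" where
  "ehrhart_poly n c k = smult (1 / fact (n - 1)) (\<Sum>J\<in>Pow {1..n}. if capacity n c J < k
     then [:1, of_bool (n - 1 \<in> J):] * pcompose (cycle_poly n (card J)) [:0, real k - real (capacity n c J):] else 0)"

lemma fps_nth_mult_signed_monomial:
  fixes f :: "nat \<Rightarrow> real"
  shows "fps_nth (Abs_fps f * ((-1) ^ j * fps_const a * fps_X ^ d)) m =
    a * ((-1) ^ j * (if d \<le> m then f (m - d) else 0))"
proof -
  have "(-1 :: real fps) ^ j = fps_const ((-1) ^ j)"
    by (induction j) (simp_all add: fps_const_neg[symmetric] del: fps_const_neg)
  then have "Abs_fps f * ((-1) ^ j * fps_const a * fps_X ^ d) = fps_const (a * (-1) ^ j) * (Abs_fps f * fps_X ^ d)"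
    by (simp only: fps_const_mult[symmetric] mult_ac)
  then show ?thesis by (simp only: fps_mult_left_const_nth fps_nth_mult_X_power mult.assoc)
qed

lemma poly_ehrhart_poly:
  assumes "n \<ge> 2" "t > 0" "k > 0"
  shows "poly (ehrhart_poly n c k) (real t) = real (card (dilate t (slice n c k) \<inter> int_lattice n))"
proof -
  have inv: "inverse ((1 - fps_X :: real fps) ^ n) = Abs_fps (\<lambda>j. real ((n + j - 1) choose j))"
    using one_minus_const_fps_X_neg_power'[of n "1 :: real"] assms by simp
  let ?e = "capacity n c"
  let ?b = "\<lambda>J. (if t * ?e J + card J \<le> t * k
       then real ((n + (t * k - (t * ?e J + card J)) - 1) choose (t * k - (t * ?e J + card J))) else 0)"
  have "fact (n - 1) * real (card (dilate t (slice n c k) \<inter> int_lattice n)) =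
    fact (n - 1) * (\<Sum>J\<in>Pow {1..n}. (1 + real t * of_bool (n - 1 \<in> J)) * ((-1) ^ card J * ?b J))"
  proof -
    show ?thesis
      unfolding lattice_points_series[OF assms(2,1)] inv sum_distrib_left fps_sum_nth fps_nth_mult_signed_monomial ..
  qed
  also have "\<dots> = (\<Sum>J\<in>Pow {1..n}. (1 + real t * of_bool (n - 1 \<in> J)) * (fact (n - 1) * ((-1) ^ card J * ?b J)))"
    by (simp only: sum_distrib_left mult_ac)
  also have "\<dots> = (\<Sum>J\<in>Pow {1..n}. (1 + real t * of_bool (n - 1 \<in> J)) *
     (if ?e J < k then poly (cycle_poly n (card J)) (real t * (real k - real (?e J))) else 0))"
    using ehrhart_term[of n t k] assms by (intro sum.cong) auto
  also have "\<dots> = fact (n - 1) * poly (ehrhart_poly n c k) (real t)"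
    unfolding ehrhart_poly_def by (simp add: poly_sum poly_pcompose if_distrib[of "\<lambda>p. poly p _"] mult_ac cong: if_cong)
      (intro sum.cong, auto simp: algebra_simps)
  finally show ?thesis by simp
qed

section \<open>Uniqueness and coefficients of the Ehrhart polynomial\<close>

lemma poly_eq_if_eq_on_positive_nats:
  fixes p q :: "real poly"
  assumes "\<And>t :: nat. t > 0 \<Longrightarrow> poly p (real t) = poly q (real t)"
  shows "p = q"
proof (rule ccontr)
  assume "p \<noteq> q"
  then have "finite {x. poly (p - q) x = 0}" by (intro poly_roots_finite) simp
  moreover have "real ` {0<..} \<subseteq> {x. poly (p - q) x = 0}" using assms by auto
  ultimately have "finite (real ` {0<..})" by (rule rev_finite_subset)
  then show False by (simp add: finite_image_iff inj_on_def infinite_Ioi)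
qed

lemma ehr_slice:
  assumes "n \<ge> 2" "k > 0"
  shows "ehr n (slice n c k) = ehrhart_poly n c k"
  unfolding ehr_def
proof (rule the_equality)
  show "\<forall>t>0. poly (ehrhart_poly n c k) (real t) = real (card (dilate t (slice n c k) \<inter> int_lattice n))"
    using poly_ehrhart_poly assms by blast
  then show "q = ehrhart_poly n c k"
    if "\<forall>t>0. poly q (real t) = real (card (dilate t (slice n c k) \<inter> int_lattice n))" for q
    using that by (intro poly_eq_if_eq_on_positive_nats) simp
qed

text \<open>The constant 1 of the linear factor contributes in degree \<open>m\<close> and will
  match \<open>S1\<close> and \<open>S2\<close>; its term in \<open>t\<close> shifts the degree to
  \<open>m - 1\<close> and will match \<open>S3\<close> and \<open>S4\<close>.\<close>

lemma coeff_ehr_slice: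
  fixes c :: "nat \<Rightarrow> nat"
  assumes "n \<ge> 2" "k > 0"
  defines "e \<equiv> capacity n c"
  shows "coeff (smult (fact (n - 1)) (ehr n (slice n c k))) m =
    (\<Sum>J\<in>Pow {1..n}. of_bool (e J < k) * ((real k - real (e J)) ^ m * coeff (cycle_poly n (card J)) m)) +
    (if m = 0 then 0 else \<Sum>J\<in>Pow {1..n}. of_bool (e J < k) * (of_bool (n - 1 \<in> J) *
        ((real k - real (e J)) ^ (m - 1) * coeff (cycle_poly n (card J)) (m - 1))))"
proof -
  have "coeff (smult (fact (n - 1)) (ehr n (slice n c k))) m = (\<Sum>J\<in>Pow {1..n}. coeff (if e J < k
     then [:1, of_bool (n - 1 \<in> J):] * pcompose (cycle_poly n (card J)) [:0, real k - real (e J):] else 0) m)"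
    unfolding ehr_slice[OF assms(1,2)] ehrhart_poly_def e_def by (simp add: coeff_sum)
  also have "\<dots> = (\<Sum>J\<in>Pow {1..n}. of_bool (e J < k) * ((real k - real (e J)) ^ m * coeff (cycle_poly n (card J)) m) +
    (if m = 0 then 0 else of_bool (e J < k) * (of_bool (n - 1 \<in> J) *
        ((real k - real (e J)) ^ (m - 1) * coeff (cycle_poly n (card J)) (m - 1)))))"
    by (rule sum.cong) (auto simp: coeff_pcompose_linear coeff_pCons poly_0_coeff_0 split: nat.splits)
  finally show ?thesis by (simp add: sum.distrib)
qed


section \<open>Comparison with the four sets\<close>

lemma mem_cyc_iff:
  assumes "\<sigma> permutes {1..n}" "\<gamma> \<in> cyc n \<sigma>"
  shows "i \<in> \<gamma> \<longleftrightarrow> \<gamma> = orbit \<sigma> i"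
proof -
  have ps: "permutation \<sigma>" using assms(1) by (auto simp: permutation_permutes)
  have "cyclic_on \<sigma> \<gamma>" using assms(2) cyclic_on_orbit'[OF ps] by (auto simp: cyc_def)
  then show ?thesis using orbit_cyclic_eq3 permutation_self_in_orbit[OF ps] by metis
qed

lemma proper_iff_less_capacity:
  assumes "n \<ge> 2" "\<sigma> permutes {1..n}" "\<gamma> \<in> cyc n \<sigma>"
  shows "proper n c w \<gamma> \<longleftrightarrow> w \<gamma> < capacity n c \<gamma>"
proof -
  have sub: "\<gamma> \<subseteq> {1..n}" using assms(3) permutes_orbit_subset[OF assms(2)] unfolding cyc_def by blast
  have "(\<Sum>i | i \<in> \<gamma> \<and> i \<le> n - 2. c i) = (\<Sum>i\<in>\<gamma> \<inter> {1..n-2}. c i)"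
    by (rule sum.cong) (use sub in auto)
  moreover have "\<gamma> \<inter> {1..n-2} = \<gamma>" if "n - 1 \<notin> \<gamma>" "n \<notin> \<gamma>"
    using sub that unfolding insert_last_two[OF assms(1)] by blast
  ultimately show ?thesis by (auto simp: proper_def capacity_def)
qed

lemma capacity_orbit_last:
  assumes "n \<ge> 2" "\<sigma> permutes {1..n}" "n - 1 \<notin> orbit \<sigma> n"
  shows "capacity n c (orbit \<sigma> n) - 1 = (\<Sum>i\<in>orbit \<sigma> n - {n}. c i)"
proof -
  have "n \<in> {1..n}" using assms(1) by simp
  then have "orbit \<sigma> n \<subseteq> {1..n}" by (rule permutes_orbit_subset[OF assms(2)])
  then have "orbit \<sigma> n \<inter> {1..n-2} = orbit \<sigma> n - {n}"
    using assms(1,3) unfolding insert_last_two[OF assms(1)] by auto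
  moreover have "n \<in> orbit \<sigma> n"
    by (rule permutation_self_in_orbit) (use assms(2) in \<open>auto simp: permutation_permutes\<close>)
  ultimately show ?thesis by (simp add: capacity_def)
qed

lemma orbit_in_cyc: "i \<in> {1..n} \<Longrightarrow> orbit \<sigma> i \<in> cyc n \<sigma>"
  by (simp add: cyc_def)

lemma cowps_type_Collect_cong:
  assumes "\<And>\<sigma> w. \<sigma> permutes {1..n} \<Longrightarrow> P \<sigma> w \<longleftrightarrow> Q \<sigma> w"
  shows "{(\<sigma>, p, w) \<in> cowps_type n r k. P \<sigma> w} = {(\<sigma>, p, w) \<in> cowps_type n r k. Q \<sigma> w}"
  using assms by (auto simp: cowps_type_def cowps_def)

lemma S2_eq:
  assumes "n \<ge> 2"
  shows "S2 n c k m = {(\<sigma>, p, w) \<in> cowps_type n (m + 1) k. orbit \<sigma> (n - 1) \<noteq> orbit \<sigma> n \<and>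
    (\<forall>\<gamma>\<in>cyc n \<sigma>. w \<gamma> \<in> (if n - 1 \<in> \<gamma> then {capacity n c \<gamma>..}
      else if n \<in> \<gamma> then {capacity n c \<gamma> - 1} else {..<capacity n c \<gamma>}))}"
proof -
  have "(\<forall>\<gamma>\<in>cyc n \<sigma>. n - 1 \<notin> \<gamma> \<longrightarrow> proper n c w \<gamma>) \<and> \<not> proper n c w (orbit \<sigma> (n - 1)) \<and>
     w (orbit \<sigma> n) = (\<Sum>i\<in>orbit \<sigma> n - {n}. c i) \<longleftrightarrow>
     (\<forall>\<gamma>\<in>cyc n \<sigma>. w \<gamma> \<in> (if n - 1 \<in> \<gamma> then {capacity n c \<gamma>..}
      else if n \<in> \<gamma> then {capacity n c \<gamma> - 1} else {..<capacity n c \<gamma>}))" (is "?L \<longleftrightarrow> ?R")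
    if s: "\<sigma> permutes {1..n}" and d: "orbit \<sigma> (n - 1) \<noteq> orbit \<sigma> n" for \<sigma> and w :: "nat set \<Rightarrow> nat"
  proof -
    have o: "orbit \<sigma> (n - 1) \<in> cyc n \<sigma>" "orbit \<sigma> n \<in> cyc n \<sigma>"
      using assms by (auto intro!: orbit_in_cyc)
    have iff: "n - 1 \<in> \<gamma> \<longleftrightarrow> \<gamma> = orbit \<sigma> (n - 1)" "n \<in> \<gamma> \<longleftrightarrow> \<gamma> = orbit \<sigma> n"
      "proper n c w \<gamma> \<longleftrightarrow> w \<gamma> < capacity n c \<gamma>" if "\<gamma> \<in> cyc n \<sigma>" for \<gamma>
      using mem_cyc_iff[OF s that] proper_iff_less_capacity[OF assms s that] by blast+
    have "n - 1 \<notin> orbit \<sigma> n" "n \<in> orbit \<sigma> n" using iff(1,2)[OF o(2)] d by auto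
    \<comment> \<open>Positivity makes \<open>capacity - 1\<close> smaller than the capacity, so the
      prescribed weight of the cycle of \<open>n\<close> is itself proper, as the first condition of
      \<open>S2\<close> demands.\<close>
    then have cap: "(\<Sum>i\<in>orbit \<sigma> n - {n}. c i) = capacity n c (orbit \<sigma> n) - 1" "capacity n c (orbit \<sigma> n) > 0"
      using capacity_orbit_last[OF assms s] by (simp_all add: capacity_def)
    show ?thesis
    proof
      assume ?L
      then show ?R using iff o cap by (simp add: not_less)
    next
      assume R: ?R
      have "proper n c w \<gamma>" if "\<gamma> \<in> cyc n \<sigma>" "n - 1 \<notin> \<gamma>" for \<gamma>
        using bspec[OF R that(1)] that iff cap by (auto split: if_splits)
      moreover have "\<not> proper n c w (orbit \<sigma> (n - 1))"
        using bspec[OF R o(1)] iff[OF o(1)] by simp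
      moreover have "w (orbit \<sigma> n) = (\<Sum>i\<in>orbit \<sigma> n - {n}. c i)"
        using bspec[OF R o(2)] iff[OF o(2)] d cap by simp
      ultimately show ?L by blast
    qed
  qed
  then show ?thesis
    unfolding S2_def by (intro cowps_type_Collect_cong) blast
qed

text \<open>The same weight ranges describe \<open>S3\<close> and \<open>S4\<close>: in \<open>S4\<close> the cycle of \<open>n\<close> contains \<open>n - 1\<close>,
  so the second case does not occur.\<close>

definition improper_range :: "nat \<Rightarrow> (nat \<Rightarrow> nat) \<Rightarrow> nat set \<Rightarrow> nat set" where
  "improper_range n c \<gamma> = (if n - 1 \<in> \<gamma> then {capacity n c \<gamma>..}
     else if n \<in> \<gamma> then {..<capacity n c \<gamma> - 1} else {..<capacity n c \<gamma>})"

lemma S3_eq: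
  assumes "n \<ge> 2"
  shows "S3 n c k m = {(\<sigma>, p, w) \<in> cowps_type n m k. orbit \<sigma> (n - 1) \<noteq> orbit \<sigma> n \<and>
    (\<forall>\<gamma>\<in>cyc n \<sigma>. w \<gamma> \<in> improper_range n c \<gamma>)}"
proof -
  have "(\<forall>\<gamma>\<in>cyc n \<sigma>. n - 1 \<notin> \<gamma> \<and> n \<notin> \<gamma> \<longrightarrow> proper n c w \<gamma>) \<and> \<not> proper n c w (orbit \<sigma> (n - 1)) \<and>
     w (orbit \<sigma> n) < (\<Sum>i\<in>orbit \<sigma> n - {n}. c i) \<longleftrightarrow>
     (\<forall>\<gamma>\<in>cyc n \<sigma>. w \<gamma> \<in> improper_range n c \<gamma>)" (is "?L \<longleftrightarrow> ?R")
    if s: "\<sigma> permutes {1..n}" and d: "orbit \<sigma> (n - 1) \<noteq> orbit \<sigma> n" for \<sigma> and w :: "nat set \<Rightarrow> nat"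
  proof -
    have o: "orbit \<sigma> (n - 1) \<in> cyc n \<sigma>" "orbit \<sigma> n \<in> cyc n \<sigma>"
      using assms by (auto intro!: orbit_in_cyc)
    have iff: "n - 1 \<in> \<gamma> \<longleftrightarrow> \<gamma> = orbit \<sigma> (n - 1)" "n \<in> \<gamma> \<longleftrightarrow> \<gamma> = orbit \<sigma> n"
      "proper n c w \<gamma> \<longleftrightarrow> w \<gamma> < capacity n c \<gamma>" if "\<gamma> \<in> cyc n \<sigma>" for \<gamma>
      using mem_cyc_iff[OF s that] proper_iff_less_capacity[OF assms s that] by blast+
    have "n - 1 \<notin> orbit \<sigma> n" using iff(1)[OF o(2)] d by auto
    then have cap: "(\<Sum>i\<in>orbit \<sigma> n - {n}. c i) = capacity n c (orbit \<sigma> n) - 1"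
      using capacity_orbit_last[OF assms s] by simp
    show ?thesis
    proof
      assume ?L
      then show ?R using iff o cap by (simp add: improper_range_def not_less)
    next
      assume R: ?R
      have "proper n c w \<gamma>" if "\<gamma> \<in> cyc n \<sigma>" "n - 1 \<notin> \<gamma> \<and> n \<notin> \<gamma>" for \<gamma>
        using bspec[OF R that(1)] that iff by (auto simp: improper_range_def split: if_splits)
      moreover have "\<not> proper n c w (orbit \<sigma> (n - 1))"
        using bspec[OF R o(1)] iff[OF o(1)] by (simp add: improper_range_def)
      moreover have "w (orbit \<sigma> n) < (\<Sum>i\<in>orbit \<sigma> n - {n}. c i)"
        using bspec[OF R o(2)] iff[OF o(2)] d cap by (simp add: improper_range_def)
      ultimately show ?L by blast
    qed
  qed
  then show ?thesis
    unfolding S3_def by (intro cowps_type_Collect_cong) blast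
qed

lemma S4_eq:
  assumes "n \<ge> 2" "m > 1"
  shows "S4 n c k m = {(\<sigma>, p, w) \<in> cowps_type n m k. orbit \<sigma> (n - 1) = orbit \<sigma> n \<and>
    (\<forall>\<gamma>\<in>cyc n \<sigma>. w \<gamma> \<in> improper_range n c \<gamma>)}"
proof -
  have "\<not> proper n c w (orbit \<sigma> n) \<and> (\<forall>\<gamma>\<in>cyc n \<sigma>. \<gamma> \<noteq> orbit \<sigma> n \<longrightarrow> proper n c w \<gamma>) \<longleftrightarrow>
     (\<forall>\<gamma>\<in>cyc n \<sigma>. w \<gamma> \<in> improper_range n c \<gamma>)" (is "?L \<longleftrightarrow> ?R")
    if s: "\<sigma> permutes {1..n}" and d: "orbit \<sigma> (n - 1) = orbit \<sigma> n" for \<sigma> and w :: "nat set \<Rightarrow> nat"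
  proof -
    have o: "orbit \<sigma> n \<in> cyc n \<sigma>" using assms by (auto intro!: orbit_in_cyc)
    have iff: "w \<gamma> \<in> improper_range n c \<gamma> \<longleftrightarrow> (if \<gamma> = orbit \<sigma> n then \<not> proper n c w \<gamma> else proper n c w \<gamma>)"
      if "\<gamma> \<in> cyc n \<sigma>" for \<gamma>
      using mem_cyc_iff[OF s that] proper_iff_less_capacity[OF assms(1) s that] d
      by (auto simp: improper_range_def)
    show ?thesis using iff o by (metis (no_types, lifting))
  qed
  then show ?thesis
    unfolding S4_def if_P[OF assms(2)] by (intro cowps_type_Collect_cong conj_cong refl)
qed

lemma S3_empty:
  assumes "n \<ge> 2" "m \<le> 1"
  shows "S3 n c k m = {}"
proof -
  have "orbit \<sigma> (n - 1) = orbit \<sigma> n" if "card (cyc n \<sigma>) = m" for \<sigma>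
  proof -
    have "finite (cyc n \<sigma>)" by (simp add: cyc_def)
    moreover have "card (cyc n \<sigma>) \<le> 1" using that assms by simp
    moreover have "orbit \<sigma> (n - 1) \<in> cyc n \<sigma>" "orbit \<sigma> n \<in> cyc n \<sigma>"
      using assms by (auto intro!: orbit_in_cyc)
    ultimately show ?thesis by (simp add: card_le_Suc0_iff_eq)
  qed
  then show ?thesis by (auto simp: S3_def cowps_type_def)
qed

lemma S2_empty:
  assumes "n \<ge> 2"
  shows "S2 n c k 0 = {}"
proof -
  have "orbit \<sigma> (n - 1) = orbit \<sigma> n" if "card (cyc n \<sigma>) = 1" for \<sigma>
  proof -
    have "orbit \<sigma> (n - 1) \<in> cyc n \<sigma>" "orbit \<sigma> n \<in> cyc n \<sigma>"
      using assms by (auto intro!: orbit_in_cyc)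
    then show ?thesis using that by (auto simp: card_1_singleton_iff)
  qed
  then show ?thesis by (auto simp: S2_def cowps_type_def)
qed

section \<open>Cardinalities of the four sets\<close>

lemma sum_cycle_sets_series:
  fixes f :: "nat \<Rightarrow> real" and b :: "nat set \<Rightarrow> bool"
  shows "(\<Sum>\<sigma> | \<sigma> permutes {1..n} \<and> card (cyc n \<sigma>) = r. fps_nth (Abs_fps f *
      (\<Sum>T\<in>Pow (cyc n \<sigma>). (-1) ^ card T * (of_bool (b (\<Union>T)) * fps_X ^ d (\<Union>T)))) k) =
    (\<Sum>J\<in>Pow {1..n}. coeff (pochhammer (- [:0, 1:]) (card J) * pochhammer [:0, 1:] (n - card J)) r *
      (of_bool (b J) * (if d J \<le> k then f (k - d J) else 0)))"
proof -
  have "(-1) ^ card T * (of_bool (b (\<Union>T)) * fps_X ^ d (\<Union>T)) =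
      (-1) ^ card T * fps_const (of_bool (b (\<Union>T))) * (fps_X :: real fps) ^ d (\<Union>T)" for T :: "nat set set"
    by (cases "b (\<Union>T)") auto
  then show ?thesis
    unfolding sum_signed_cycle_sets_coeff[symmetric] sum_distrib_left fps_sum_nth
    by (simp only: fps_nth_mult_signed_monomial mult.left_commute)
qed

text \<open>For each \<open>\<sigma>\<close> the two counts are coefficients of the two products in
  \<open>cycle_sum_products\<close>, whose sum depends only on unions of cycles. The bound is
  \<open>\<le>\<close>: a set of capacity \<open>k\<close> contributes \<open>0 ^ m\<close>, which
  is 1 for \<open>m = 0\<close>.\<close>

lemma card_compatible_S2:
  assumes "n \<ge> 2"
  shows "real (card {T \<in> cowps_type n (m + 1) k. compatible n c T}) + real (card (S2 n c k m)) =
    (\<Sum>J\<in>Pow {1..n}. coeff (cycle_poly n (card J)) m *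
      (if capacity n c J \<le> k then real (k - capacity n c J) ^ m else 0))"
proof -
  let ?d = "capacity n c" and ?P = "Abs_fps (\<lambda>j. real j ^ m)"
  let ?V = "\<lambda>\<gamma>. if n - 1 \<in> \<gamma> then {?d \<gamma>..} else if n \<in> \<gamma> then {?d \<gamma> - 1} else {..<?d \<gamma>}"
  let ?\<Sigma> = "{\<sigma>. \<sigma> permutes {1..n} \<and> card (cyc n \<sigma>) = m + 1}"
  let ?b = "\<lambda>\<sigma>. orbit \<sigma> (n - 1) \<noteq> orbit \<sigma> n"
  have fin: "finite ?\<Sigma>"
    by (rule finite_subset[OF _ finite_permutations[of "{1..n}"]]) auto
  have n1: "n \<ge> 1" using assms by simp
  have comp: "{T \<in> cowps_type n (m + 1) k. compatible n c T} =
     {(\<sigma>, p, w) \<in> cowps_type n (m + 1) k. True \<and> (\<forall>\<gamma>\<in>cyc n \<sigma>. w \<gamma> \<in> {..<?d \<gamma>})}"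
    using proper_iff_less_capacity[OF assms]
    by (auto simp: compatible_def cowps_type_def cowps_def)
  have c1: "real (card {T \<in> cowps_type n (m + 1) k. compatible n c T}) =
     (\<Sum>\<sigma>\<in>?\<Sigma>. fps_nth (?P * (\<Prod>\<gamma>\<in>cyc n \<sigma>. (1 - fps_X) * indicator_fps {..<?d \<gamma>})) k)"
    unfolding comp card_cowps_type(1)[OF n1, where Q = "\<lambda>_. True" and U = "\<lambda>_ \<gamma>. {..<?d \<gamma>}"] by simp
  have "real (card (S2 n c k m)) =
     (\<Sum>\<sigma> | \<sigma> permutes {1..n} \<and> card (cyc n \<sigma>) = m + 1 \<and> ?b \<sigma>.
       fps_nth (?P * (\<Prod>\<gamma>\<in>cyc n \<sigma>. (1 - fps_X) * indicator_fps (?V \<gamma>))) k)"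
    unfolding S2_eq[OF assms] card_cowps_type(1)[OF n1, where Q = ?b and U = "\<lambda>_. ?V"] by simp
  also have "\<dots> = (\<Sum>\<sigma>\<in>?\<Sigma>. if ?b \<sigma> then
       fps_nth (?P * (\<Prod>\<gamma>\<in>cyc n \<sigma>. (1 - fps_X) * indicator_fps (?V \<gamma>))) k else 0)"
    using fin by (subst sum.inter_filter[symmetric]) (auto intro!: sum.cong)
  finally have "real (card {T \<in> cowps_type n (m + 1) k. compatible n c T}) + real (card (S2 n c k m)) =
     (\<Sum>\<sigma>\<in>?\<Sigma>. fps_nth (?P * (\<Prod>\<gamma>\<in>cyc n \<sigma>. (1 - fps_X) * indicator_fps {..<?d \<gamma>})) k +
       (if ?b \<sigma> then fps_nth (?P * (\<Prod>\<gamma>\<in>cyc n \<sigma>. (1 - fps_X) * indicator_fps (?V \<gamma>))) k else 0))"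
    unfolding c1 by (simp only: sum.distrib)
  also have "\<dots> = (\<Sum>\<sigma>\<in>?\<Sigma>. fps_nth (?P * (\<Sum>T\<in>Pow (cyc n \<sigma>). (-1) ^ card T *
      (of_bool True * fps_X ^ ?d (\<Union>T)))) k)"
  proof (rule sum.cong)
    fix \<sigma> assume "\<sigma> \<in> ?\<Sigma>"
    then have s: "\<sigma> permutes {1..n}" by simp
    have "fps_nth (?P * A) k + (if b then fps_nth (?P * B) k else 0) = fps_nth (?P * (A + (if b then B else 0))) k"
      for A B and b by (simp add: distrib_left)
    then show "fps_nth (?P * (\<Prod>\<gamma>\<in>cyc n \<sigma>. (1 - fps_X) * indicator_fps {..<?d \<gamma>})) k +
       (if ?b \<sigma> then fps_nth (?P * (\<Prod>\<gamma>\<in>cyc n \<sigma>. (1 - fps_X) * indicator_fps (?V \<gamma>))) k else 0) =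
      fps_nth (?P * (\<Sum>T\<in>Pow (cyc n \<sigma>). (-1) ^ card T * (of_bool True * fps_X ^ ?d (\<Union>T)))) k"
      by (simp only: cycle_sum_products(1)[OF assms s] of_bool_eq mult_1_left)
  qed simp
  also have "\<dots> = (\<Sum>J\<in>Pow {1..n}. coeff (pochhammer (- [:0, 1:]) (card J) * pochhammer [:0, 1:] (n - card J)) (m + 1) *
      (of_bool True * (if ?d J \<le> k then real (k - ?d J) ^ m else 0)))"
    by (rule sum_cycle_sets_series)
  also have "\<dots> = (\<Sum>J\<in>Pow {1..n}. coeff (cycle_poly n (card J)) m *
      (if ?d J \<le> k then real (k - ?d J) ^ m else 0))"
  proof (rule sum.cong)
    fix J assume "J \<in> Pow {1..n}"
    then have "card J \<le> n" using card_mono[of "{1..n}" J] by simp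
    then show "coeff (pochhammer (- [:0, 1:]) (card J) * pochhammer [:0, 1:] (n - card J)) (m + 1) *
      (of_bool True * (if ?d J \<le> k then real (k - ?d J) ^ m else 0)) =
      coeff (cycle_poly n (card J)) m * (if ?d J \<le> k then real (k - ?d J) ^ m else 0)"
      using coeff_pochhammer_split[OF n1] by (simp only: Suc_eq_plus1[symmetric] of_bool_eq mult_1_left)
  qed simp
  finally show ?thesis .
qed

text \<open>\<open>S3\<close> and \<open>S4\<close> share the same weight ranges and differ only in
  whether \<open>n - 1\<close> and \<open>n\<close> lie in one cycle, so their union runs over all
  permutations with \<open>m\<close> cycles and the second identity of
  \<open>cycle_sum_products\<close> applies.\<close>

lemma card_S3_S4:
  assumes "n \<ge> 2" "m > 1"
  shows "real (card (S3 n c k m \<union> S4 n c k m)) =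
    - (\<Sum>J\<in>Pow {1..n}. coeff (cycle_poly n (card J)) (m - 1) * (of_bool (n - 1 \<in> J) *
      (if capacity n c J \<le> k then real (k - capacity n c J) ^ (m - 1) else 0)))"
proof -
  let ?d = "capacity n c" and ?P = "Abs_fps (\<lambda>j. real j ^ (m - 1))"
  let ?\<Sigma> = "{\<sigma>. \<sigma> permutes {1..n} \<and> card (cyc n \<sigma>) = m}"
  have n1: "n \<ge> 1" using assms by simp
  have "S3 n c k m \<union> S4 n c k m =
     {(\<sigma>, p, w) \<in> cowps_type n m k. True \<and> (\<forall>\<gamma>\<in>cyc n \<sigma>. w \<gamma> \<in> improper_range n c \<gamma>)}"
    unfolding S3_eq[OF assms(1)] S4_eq[OF assms] by auto
  then have "real (card (S3 n c k m \<union> S4 n c k m)) = (\<Sum>\<sigma>\<in>?\<Sigma>. fps_nth (?P *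
      (\<Prod>\<gamma>\<in>cyc n \<sigma>. (1 - fps_X) * indicator_fps (improper_range n c \<gamma>))) k)"
    using card_cowps_type(1)[OF n1, where Q = "\<lambda>_. True" and U = "\<lambda>_. improper_range n c"] by simp
  also have "\<dots> = (\<Sum>\<sigma>\<in>?\<Sigma>. - fps_nth (?P * (\<Sum>T\<in>Pow (cyc n \<sigma>). (-1) ^ card T *
      (of_bool (n - 1 \<in> \<Union>T) * fps_X ^ ?d (\<Union>T)))) k)"
  proof (rule sum.cong)
    fix \<sigma> assume "\<sigma> \<in> ?\<Sigma>"
    then have s: "\<sigma> permutes {1..n}" by simp
    show "fps_nth (?P * (\<Prod>\<gamma>\<in>cyc n \<sigma>. (1 - fps_X) * indicator_fps (improper_range n c \<gamma>))) k =
      - fps_nth (?P * (\<Sum>T\<in>Pow (cyc n \<sigma>). (-1) ^ card T * (of_bool (n - 1 \<in> \<Union>T) * fps_X ^ ?d (\<Union>T)))) k"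
      unfolding improper_range_def cycle_sum_products(2)[OF assms(1) s] mult_minus_right fps_neg_nth ..
  qed simp
  also have "\<dots> = - (\<Sum>J\<in>Pow {1..n}. coeff (pochhammer (- [:0, 1:]) (card J) * pochhammer [:0, 1:] (n - card J)) m *
      (of_bool (n - 1 \<in> J) * (if ?d J \<le> k then real (k - ?d J) ^ (m - 1) else 0)))"
    unfolding sum_negf by (simp only: sum_cycle_sets_series)
  also have "\<dots> = - (\<Sum>J\<in>Pow {1..n}. coeff (cycle_poly n (card J)) (m - 1) *
      (of_bool (n - 1 \<in> J) * (if ?d J \<le> k then real (k - ?d J) ^ (m - 1) else 0)))"
  proof (intro arg_cong[of _ _ uminus] sum.cong)
    fix J assume "J \<in> Pow {1..n}"
    then have "card J \<le> n" using card_mono[of "{1..n}" J] by simp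
    moreover have "m = Suc (m - 1)" using assms by simp
    ultimately have "coeff (pochhammer (- [:0, 1:]) (card J) * pochhammer [:0, 1:] (n - card J)) m
      = coeff (cycle_poly n (card J)) (m - 1)"
      using coeff_pochhammer_split[OF n1, of "card J" "m - 1"] by metis
    then show "coeff (pochhammer (- [:0, 1:]) (card J) * pochhammer [:0, 1:] (n - card J)) m *
      (of_bool (n - 1 \<in> J) * (if ?d J \<le> k then real (k - ?d J) ^ (m - 1) else 0)) =
      coeff (cycle_poly n (card J)) (m - 1) *
      (of_bool (n - 1 \<in> J) * (if ?d J \<le> k then real (k - ?d J) ^ (m - 1) else 0))"
      by (simp only:)
  qed simp
  finally show ?thesis .
qed

text \<open>A permutation with one cycle carries exactly one triple: the order is trivial and has no
  descents, so the weight is \<open>k\<close>. It remains to count the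
  \<open>n\<close>-cycles.\<close>

lemma card_cowps_type_one_cycle:
  assumes "n \<ge> 2"
  shows "real (card (cowps_type n 1 k)) = fact (n - 1)"
proof -
  have n1: "n \<ge> 1" using assms by simp
  have "cowps_type n 1 k = {(\<sigma>, p, w) \<in> cowps_type n 1 k. True \<and> (\<forall>\<gamma>\<in>cyc n \<sigma>. w \<gamma> \<in> UNIV)}" by auto
  then have "real (card (cowps_type n 1 k)) =
    (\<Sum>\<sigma> | \<sigma> permutes {1..n} \<and> card (cyc n \<sigma>) = 1. 1)"
    using card_cowps_type(1)[OF n1, where Q = "\<lambda>_. True" and U = "\<lambda>_ _. UNIV" and r = 1 and k = k]
    unfolding one_minus_X_indicator_UNIV by simp
  \<comment> \<open>Orbits are nonempty, so only \<open>T = {}\<close> has empty union. Writing 1 in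
    this way lets the signed cycle sum count the permutations with one cycle.\<close>
  also have "\<dots> = (\<Sum>\<sigma> | \<sigma> permutes {1..n} \<and> card (cyc n \<sigma>) = 1. \<Sum>T\<in>Pow (cyc n \<sigma>). (-1) ^ card T * of_bool (\<Union>T = {}))"
  proof (rule sum.cong)
    fix \<sigma> :: "nat \<Rightarrow> nat"
    have fin: "finite (cyc n \<sigma>)" by (simp add: cyc_def)
    have "\<Union>T = {} \<longleftrightarrow> T = {}" if "T \<in> Pow (cyc n \<sigma>)" for T
      using that orbit_nonempty by (fastforce simp: cyc_def)
    then have "(\<Sum>T\<in>Pow (cyc n \<sigma>). (-1) ^ card T * of_bool (\<Union>T = {})) = (\<Sum>T\<in>Pow (cyc n \<sigma>). if T = {} then 1 else 0 :: real)"
      by (intro sum.cong) auto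
    then show "1 = (\<Sum>T\<in>Pow (cyc n \<sigma>). (-1) ^ card T * of_bool (\<Union>T = {}) :: real)" using fin by simp
  qed simp
  also have "\<dots> = (\<Sum>J\<in>Pow {1..n}. coeff (pochhammer (- [:0, 1:]) (card J) * pochhammer [:0, 1:] (n - card J)) 1 * of_bool (J = {}))"
    by (rule sum_signed_cycle_sets_coeff)
  also have "\<dots> = (\<Sum>J\<in>Pow {1..n}. if J = {} then coeff (cycle_poly n 0) 0 else 0)"
    using coeff_pochhammer_split[OF n1, of 0 0] by (intro sum.cong) auto
  also have "\<dots> = fact (n - 1)"
    using poly_cycle_poly_0[OF n1, of 0] by (simp add: poly_0_coeff_0)
  finally show ?thesis .
qed

lemma finite_cowps_type: "n \<ge> 1 \<Longrightarrow> finite (cowps_type n r k)"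
  using card_cowps_type(2)[where Q = "\<lambda>_. True" and U = "\<lambda>_ _. UNIV"] by simp

lemma slice_nonempty_le:
  assumes "n \<ge> 2" "slice n c k \<noteq> {}"
  shows "k \<le> capacity n c {1..n}"
proof -
  obtain x where x: "x \<in> slice n c k" using assms by blast
  have n: "n - 1 \<noteq> n" "n - 1 \<notin> insert n {1..n-2}" "n \<notin> {1..n-2}" using assms by auto
  have "real k = (\<Sum>i\<in>{1..n-2}. x i) + (x (n - 1) + x n)"
    using x n unfolding slice_def insert_last_two[OF assms(1)] by simp
  also have "(\<Sum>i\<in>{1..n-2}. x i) \<le> (\<Sum>i\<in>{1..n-2}. real (c i))"
    using x by (intro sum_mono) (auto simp: slice_def)
  also have "x (n - 1) + x n \<le> 1" using x by (simp add: slice_def)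
  finally have "real k \<le> real (sum c {1..n-2} + 1)" by simp
  moreover have "{1..n} \<inter> {1..n-2} = {1..n-2}" by auto
  moreover have "n \<in> {1..n}" using assms by simp
  ultimately show ?thesis by (simp add: capacity_def del: of_nat_add of_nat_Suc)
qed

theorem theorem4p2:
  fixes n k m :: nat and c :: "nat \<Rightarrow> nat"
  assumes "n \<ge> 2"
    and "\<And>i. i \<in> {1..n-2} \<Longrightarrow> c i > 0"
    and "k > 0"
    and "slice n c k \<noteq> {}"
  shows "coeff (smult (fact (n - 1)) (ehr n (slice n c k))) m =
      real (card (S1 n c k m)) + real (card (S2 n c k m))
        - real (card (S3 n c k m)) - real (card (S4 n c k m))
    \<and> real (card (S1 n c k m)) + real (card (S2 n c k m))
        - real (card (S3 n c k m)) - real (card (S4 n c k m)) =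
      real (card (S1 n c k m \<union> S2 n c k m)) - real (card (S3 n c k m \<union> S4 n c k m))"
proof
  let ?d = "capacity n c"
  have n1: "n \<ge> 1" using assms(1) by simp
  have fin: "finite (S1 n c k m)" "finite (S2 n c k m)" "finite (S3 n c k m)" "finite (S4 n c k m)"
    by (rule finite_subset[OF _ finite_cowps_type[OF n1]]; auto simp: S1_def S2_def S3_def S4_def)+
  \<comment> \<open>For \<open>m = 0\<close> the set \<open>S1\<close> may contain incompatible
    triples, and disjointness comes from \<open>S2\<close> being empty. For other \<open>m\<close>
    the cycle of \<open>n - 1\<close> is proper in \<open>S1\<close> and improper in
    \<open>S2\<close>.\<close>
  have "S1 n c k m \<inter> S2 n c k m = {}"
  proof (cases "m = 0")
    case True
    then show ?thesis using S2_empty[OF assms(1)] by simp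
  next
    case False
    have "orbit \<sigma> (n - 1) \<in> cyc n \<sigma>" for \<sigma> using assms(1) by (auto intro!: orbit_in_cyc)
    then show ?thesis using False by (auto simp: S1_def S2_def compatible_def)
  qed
  then have 12: "real (card (S1 n c k m \<union> S2 n c k m)) = real (card (S1 n c k m)) + real (card (S2 n c k m))"
    using fin by (simp add: card_Un_disjoint)
  have "S3 n c k m \<inter> S4 n c k m = {}" by (auto simp: S3_def S4_def)
  then have 34: "real (card (S3 n c k m \<union> S4 n c k m)) = real (card (S3 n c k m)) + real (card (S4 n c k m))"
    using fin by (simp add: card_Un_disjoint)
  show "real (card (S1 n c k m)) + real (card (S2 n c k m))
        - real (card (S3 n c k m)) - real (card (S4 n c k m)) =
      real (card (S1 n c k m \<union> S2 n c k m)) - real (card (S3 n c k m \<union> S4 n c k m))"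
    unfolding 12 34 by simp
  \<comment> \<open>Nonemptiness rules out the spurious term \<open>J = {1..n}\<close>, which could occur only for \<open>m \<le> 1\<close>.\<close>
  have k_le: "k \<le> ?d {1..n}" by (rule slice_nonempty_le[OF assms(1,4)])
  have constant_term: "of_bool (?d J < k) * coeff (cycle_poly n (card J)) 0 = (if J = {} then fact (n - 1) else 0)"
    if "J \<in> Pow {1..n}" for J
  proof -
    have J: "finite J" "card J \<le> n" using that card_mono[of "{1..n}" J] by (auto intro: finite_subset)
    have "J = {1..n}" if "card J = n" using \<open>J \<in> Pow {1..n}\<close> that by (intro card_subset_eq) auto
    then show ?thesis
      using poly_cycle_poly_0[OF n1 J(2)] J(1) k_le assms(3) n1 unfolding poly_0_coeff_0 by auto
  qed
  have "(\<Sum>J\<in>Pow {1..n}. of_bool (?d J < k) * ((real k - real (?d J)) ^ m * coeff (cycle_poly n (card J)) m)) =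
     real (card (S1 n c k m)) + real (card (S2 n c k m))"
  proof (cases "m = 0")
    case m: True
    have "(\<Sum>J\<in>Pow {1..n}. of_bool (?d J < k) * ((real k - real (?d J)) ^ m * coeff (cycle_poly n (card J)) m)) =
      (\<Sum>J\<in>Pow {1..n}. if J = {} then fact (n - 1) else 0)"
      using constant_term m by (intro sum.cong) auto
    also have "\<dots> = fact (n - 1)" by simp
    also have "\<dots> = real (card (cowps_type n 1 k))" using card_cowps_type_one_cycle[OF assms(1)] by simp
    also have "cowps_type n 1 k = S1 n c k m"
    proof (cases "k < n - 1")
      case True
      \<comment> \<open>The single cycle is \<open>{1..n}\<close>. Its weight is at most
        \<open>k < n - 1\<close>, and its capacity is at least \<open>n - 1\<close> because the
        \<open>c i\<close> are positive; hence both branches of \<open>S1\<close> agree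
        here.\<close>
      have "compatible n c (\<sigma>, p, w)" if "(\<sigma>, p, w) \<in> cowps_type n 1 k" for \<sigma> p w
        unfolding compatible_def prod.case
      proof
        fix \<gamma> assume g: "\<gamma> \<in> cyc n \<sigma>"
        have s: "\<sigma> permutes {1..n}" "card (cyc n \<sigma>) = 1" "k = sum w (cyc n \<sigma>) + des 1 p"
          using that by (auto simp: cowps_type_def cowps_def)
        have C: "cyc n \<sigma> = {\<gamma>}" using s(2) g by (auto simp: card_1_singleton_iff)
        then have "\<gamma> = {1..n}" using Union_orbits[OF _ s(1)] by (simp add: cyc_def)
        moreover have "w \<gamma> \<le> k" using s(3) C by simp
        moreover have "n - 1 \<le> ?d {1..n}"
        proof -
          have "n - 2 = (\<Sum>i\<in>{1..n-2}. 1)" by simp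
          also have "\<dots> \<le> sum c {1..n-2}" by (intro sum_mono) (use assms(2) in \<open>auto simp: Suc_le_eq\<close>)
          finally have "n - 1 \<le> sum c {1..n-2} + 1" by simp
          moreover have "{1..n} \<inter> {1..n-2} = {1..n-2}" "n \<in> {1..n}" using n1 by auto
          ultimately show ?thesis by (simp add: capacity_def)
        qed
        ultimately show "proper n c w \<gamma>"
          using proper_iff_less_capacity[OF assms(1) s(1) g] True by simp
      qed
      then show ?thesis using True m by (auto simp: S1_def)
    next
      case False
      then show ?thesis using m by (simp add: S1_def)
    qed
    finally show ?thesis using m S2_empty[OF assms(1)] by simp
  next
    case False
    then have S1: "S1 n c k m = {T \<in> cowps_type n (m + 1) k. compatible n c T}" by (simp add: S1_def)
    \<comment> \<open>Terms with \<open>?d J = k\<close> occur only in the count of triples, as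
      \<open>0 ^ m\<close>, and vanish since \<open>m \<noteq> 0\<close>.\<close>
    show ?thesis
      unfolding S1 card_compatible_S2[OF assms(1)] using False
      by (intro sum.cong) (auto simp: of_nat_diff)
  qed
  moreover have "(if m = 0 then 0 else \<Sum>J\<in>Pow {1..n}. of_bool (?d J < k) * (of_bool (n - 1 \<in> J) *
        ((real k - real (?d J)) ^ (m - 1) * coeff (cycle_poly n (card J)) (m - 1)))) =
     - real (card (S3 n c k m \<union> S4 n c k m))"
  proof (cases "m > 1")
    case True
    then have "m \<noteq> 0" by simp
    \<comment> \<open>Again the terms with \<open>?d J = k\<close> vanish, because the exponent
      \<open>m - 1\<close> is positive.\<close>
    then show ?thesis unfolding card_S3_S4[OF assms(1) True] minus_minus if_not_P[OF \<open>m \<noteq> 0\<close>]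
      using True by (intro sum.cong) (auto simp: of_nat_diff)
  next
    case False
    then have "S3 n c k m \<union> S4 n c k m = {}" using S3_empty[OF assms(1)] by (simp add: S4_def)
    \<comment> \<open>For \<open>m = 1\<close> only constant coefficients enter. By
      \<open>constant_term\<close> they leave only \<open>J = {}\<close>, which does not contain
      \<open>n - 1\<close>.\<close>
    moreover have "(\<Sum>J\<in>Pow {1..n}. of_bool (?d J < k) * (of_bool (n - 1 \<in> J) *
        ((real k - real (?d J)) ^ (m - 1) * coeff (cycle_poly n (card J)) (m - 1)))) = 0" if "m \<noteq> 0"
    proof -
      have m: "m - 1 = 0" using that False by simp
      have "of_bool (?d J < k) * (of_bool (n - 1 \<in> J) * coeff (cycle_poly n (card J)) 0) = 0"
        if "J \<in> Pow {1..n}" for J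
        using constant_term[OF that] by (auto split: if_splits)
      then show ?thesis unfolding m power_0 mult_1_left by (intro sum.neutral) blast
    qed
    ultimately show ?thesis by simp
  qed
  ultimately show "coeff (smult (fact (n - 1)) (ehr n (slice n c k))) m =
      real (card (S1 n c k m)) + real (card (S2 n c k m))
        - real (card (S3 n c k m)) - real (card (S4 n c k m))"
    unfolding coeff_ehr_slice[OF assms(1,3)] using 34 by simp
qed

end
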